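(* Let $(X,\mu)$ be a $\sigma$-finite measure space and let $(Y_j,\nu_j)$, $1\le j\le d$, be measure spaces. Suppose that the linear operators $T_j:\mathcal{S}(Y_j)\to\mathcal{M}(X)$ are positive and that each $T_j$ saturates $X$. Suppose that $1\le p_j\le\infty$, $0<q<1$, $\alpha_j>0$, $\sum_{j=1}^d\alpha_j=1$ and that, for some $A\ge0$, $$\Big\|\prod_{j=1}^d (T_jf_j)^{\alpha_j}\Big\|_{L^q(X)}\le A\prod_{j=1}^d\|f_j\|_{L^{p_j}(Y_j)}^{\alpha_j}$$ for all nonnegative simple functions $f_j\in\mathcal{S}(Y_j)$, $1\le j\le d$. Then there exist nonnegative measurable functions $g_1,\dots,g_d$ on $X$ such that $$\Big\|\prod_{j=1}^d g_j^{\alpha_j}\Big\|_{L^{q'}(X)}=1$$ and such that for each $j$, $$\int_X g_j(x)\,T_jf_j(x)\,d\mu(x)\le A\,\|f_j\|_{L^{p_j}(Y_j)}$$ for all simple functions $f_j\in\mathcal{S}(Y_j)$.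
   Context: $\mathcal{S}(Y)$ denotes the real-valued simple functions on a measure space $Y$ (finite linear combinations of characteristic functions of measurable sets of finite measure), and $\mathcal{M}(X)$ the real-valued measurable functions on $X$. A linear map $T:\mathcal{S}(Y)\to\mathcal{M}(X)$ is positive if $f\ge0$ a.e. on $Y$ implies $Tf\ge0$ a.e. on $X$. $T$ saturates $X$ if for each measurable $E\subseteq X$ of positive measure there exist a measurable $E'\subseteq E$ with $\mu(E')>0$ and a nonnegative $h\in\mathcal{S}(Y)$ such that $Th>0$ a.e. on $E'$. For $0<q<1$, $q'=q/(q-1)<0$ is defined by $1/q+1/q'=1$, and for nonnegative $g$, $\|g\|_{L^{q'}(X)}=\left(\int_X g^{q'}\,d\mu\right)^{1/q'}$; in particular $\|g\|_{L^{q'}}=1$ entails $g>0$ a.e.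
   Formalization: The formal theorem additionally assumes μ(X) > 0; if μ(X) = 0 all hypotheses hold trivially, but the integral of any function is 0, so the L^{q'} norm (q' < 0) is infinite and can never equal 1. *)

theory Defs
  imports "HOL-Analysis.Analysis" "HOL-Probability.Essential_Supremum"
begin

text \<open>The space \<open>S(Y)\<close>; values off \<^term>\<open>space N\<close> are immaterial. The lemma \<open>simple_functions_iff\<close>
  relates it to the library's \<^const>\<open>simple_function\<close>.\<close>

definition simple_functions :: "'b measure \<Rightarrow> ('b \<Rightarrow> real) set" where
  "simple_functions N = {f. \<exists>(n::nat) (c :: nat \<Rightarrow> real) (B :: nat \<Rightarrow> 'b set).
     (\<forall>i<n. B i \<in> sets N \<and> emeasure N (B i) < \<infinity>) \<and>
     (\<forall>y\<in>space N. f y = (\<Sum>i<n. c i * indicator (B i) y))}"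

lemma simple_functions_iff:
  "f \<in> simple_functions N \<longleftrightarrow>
     simple_function N f \<and> emeasure N {y \<in> space N. f y \<noteq> 0} \<noteq> \<infinity>" (is "_ \<longleftrightarrow> ?R")
proof
  assume "f \<in> simple_functions N"
  then obtain n :: nat and c :: "nat \<Rightarrow> real" and B :: "nat \<Rightarrow> 'a set" where
    B: "\<And>i. i < n \<Longrightarrow> B i \<in> sets N" "\<And>i. i < n \<Longrightarrow> emeasure N (B i) < \<infinity>"
    and f: "\<And>y. y \<in> space N \<Longrightarrow> f y = (\<Sum>i<n. c i * indicator (B i) y)"
    unfolding simple_functions_def by blast
  have "simple_function N (\<lambda>y. \<Sum>i<n. c i * indicator (B i) y)"
  proof (rule simple_function_sum)
    fix i assume "i \<in> {..<n}"
    then have "simple_function N (indicator (B i) :: 'a \<Rightarrow> real)"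
      using B(1) by (auto intro: simple_function_indicator)
    then show "simple_function N (\<lambda>y. c i * indicator (B i) y)"
      using simple_function_mult[OF simple_function_const] by blast
  qed
  then have 1: "simple_function N f"
    using simple_function_cong[of N f "\<lambda>y. \<Sum>i<n. c i * indicator (B i) y"] f by simp
  have U: "(\<Union>i<n. B i) \<in> sets N"
    using B by auto
  have "emeasure N (\<Union>i<n. B i) \<le> (\<Sum>i<n. emeasure N (B i))"
    using B by (intro emeasure_subadditive_finite) auto
  also have "\<dots> < \<infinity>"
    using B(2) by (simp add: less_top[symmetric])
  finally have 2: "emeasure N (\<Union>i<n. B i) < \<infinity>" .
  have "{y \<in> space N. f y \<noteq> 0} \<subseteq> (\<Union>i<n. B i)"
  proof
    fix y assume y: "y \<in> {y \<in> space N. f y \<noteq> 0}"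
    show "y \<in> (\<Union>i<n. B i)"
    proof (rule ccontr)
      assume "y \<notin> (\<Union>i<n. B i)"
      then have "(\<Sum>i<n. c i * indicator (B i) y) = 0"
        by (intro sum.neutral) auto
      with y f show False by auto
    qed
  qed
  from emeasure_mono[OF this U] 2 have "emeasure N {y \<in> space N. f y \<noteq> 0} \<noteq> \<infinity>"
    by auto
  with 1 show ?R ..
next
  assume ?R
  then have sf: "simple_function N f" and fin: "emeasure N {y \<in> space N. f y \<noteq> 0} \<noteq> \<infinity>"
    by auto
  let ?V = "f ` space N - {0}"
  have V: "finite ?V"
    using sf by (auto dest: simple_functionD)
  then obtain v where v: "bij_betw v {..<card ?V} ?V"
    using ex_bij_betw_nat_finite[of ?V] by (auto simp: atLeast0LessThan)
  define B where "B i = f -` {v i} \<inter> space N" for i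
  have Bs: "B i \<in> sets N" for i
    using sf unfolding B_def by (rule simple_functionD)
  have supp: "{y \<in> space N. f y \<noteq> 0} \<in> sets N"
    using borel_measurable_simple_function[OF sf] by measurable
  have Bf: "emeasure N (B i) < \<infinity>" if "i < card ?V" for i
  proof -
    have "v i \<in> ?V" using v that by (auto simp: bij_betw_def)
    then have "B i \<subseteq> {y \<in> space N. f y \<noteq> 0}" by (auto simp: B_def)
    from emeasure_mono[OF this supp] fin show ?thesis
      by (metis infinity_ennreal_def less_top order_le_less_trans)
  qed
  have "f y = (\<Sum>i<card ?V. v i * indicator (B i) y)" if y: "y \<in> space N" for y
  proof -
    have "(\<Sum>i<card ?V. v i * indicator (B i) y)
        = (\<Sum>i<card ?V. if f y = v i then v i else 0)"
      using y by (intro sum.cong) (auto simp: B_def)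
    also have "\<dots> = (\<Sum>r\<in>?V. if f y = r then r else 0)"
      using sum.reindex_bij_betw[OF v, of "\<lambda>r. if f y = r then r else 0"] .
    also have "\<dots> = f y"
      using V y by (simp add: sum.delta)
    finally show ?thesis by simp
  qed
  with Bs Bf show "f \<in> simple_functions N"
    unfolding simple_functions_def by blast
qed

text \<open>As usual, measurable functions are identified when they agree almost everywhere, so
  linearity is an identity of almost-everywhere classes; an operator that is linear pointwise
  everywhere is a special case.\<close>

definition linear_operator ::
    "'b measure \<Rightarrow> 'a measure \<Rightarrow> (('b \<Rightarrow> real) \<Rightarrow> 'a \<Rightarrow> real) \<Rightarrow> bool" where
  "linear_operator N M T \<longleftrightarrow>
     (\<forall>f\<in>simple_functions N. T f \<in> borel_measurable M) \<and>
     (\<forall>f\<in>simple_functions N. \<forall>g\<in>simple_functions N.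
        AE x in M. T (\<lambda>y. f y + g y) x = T f x + T g x) \<and>
     (\<forall>f\<in>simple_functions N. \<forall>c. AE x in M. T (\<lambda>y. c * f y) x = c * T f x)"

definition positive_operator ::
    "'b measure \<Rightarrow> 'a measure \<Rightarrow> (('b \<Rightarrow> real) \<Rightarrow> 'a \<Rightarrow> real) \<Rightarrow> bool" where
  "positive_operator N M T \<longleftrightarrow>
     (\<forall>f\<in>simple_functions N. (AE y in N. 0 \<le> f y) \<longrightarrow> (AE x in M. 0 \<le> T f x))"

definition saturates ::
    "'b measure \<Rightarrow> 'a measure \<Rightarrow> (('b \<Rightarrow> real) \<Rightarrow> 'a \<Rightarrow> real) \<Rightarrow> bool" where
  "saturates N M T \<longleftrightarrow>
     (\<forall>E\<in>sets M. emeasure M E > 0 \<longrightarrow>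
        (\<exists>E'\<in>sets M. E' \<subseteq> E \<and> emeasure M E' > 0 \<and>
           (\<exists>h\<in>simple_functions N. (\<forall>y\<in>space N. 0 \<le> h y) \<and> (AE x\<in>E' in M. 0 < T h x))))"

text \<open>Real powers on \<open>[0, \<infinity>]\<close>, with \<open>0\<close> and \<open>\<infinity>\<close> exchanged by negative exponents. (The library's
  \<^term>\<open>0 powr a\<close> is \<open>0\<close> for every real \<open>a\<close>.)\<close>

definition epowr :: "ennreal \<Rightarrow> real \<Rightarrow> ennreal" where
  "epowr x a =
     (if a = 0 then 1
      else if x = 0 then (if a < 0 then \<infinity> else 0)
      else if x = \<infinity> then (if a < 0 then 0 else \<infinity>)
      else ennreal (enn2real x powr a))"

text \<open>The \<open>L\<^sup>r\<close> functional for \<open>r = \<infinity>\<close> and for every nonzero real \<open>r\<close>, including negative ones. Since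
  \<open>0\<close> to a negative power is \<open>\<infinity>\<close>, for \<open>r < 0\<close> a positive value forces \<open>f \<noteq> 0\<close> almost everywhere.\<close>

definition Lnorm :: "'a measure \<Rightarrow> ereal \<Rightarrow> ('a \<Rightarrow> real) \<Rightarrow> ennreal" where
  "Lnorm M r f =
     (if r = \<infinity> then esssup M (\<lambda>x. ennreal \<bar>f x\<bar>)
      else epowr (\<integral>\<^sup>+x. epowr (ennreal \<bar>f x\<bar>) (real_of_ereal r) \<partial>M) (1 / real_of_ereal r))"

end

theory Submission
  imports Defs
begin

text \<open>
  For each \<open>j\<close> let \<open>K j\<close> be the convex set of nonnegative functions \<open>T j f\<close> with \<open>f\<close> in the unit ball
  of \<open>L\<^sup>p\<close>. Write \<open>G(u) = \<Prod>j. u j powr \<alpha> j\<close> for a tuple of functions. The hypothesis bounds the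
  energy \<open>\<Phi>(u) = \<integral> G(u)\<^sup>q\<close> by \<open>A\<^sup>q\<close> on the product of the \<open>K j\<close>. Suppose that \<open>U\<close> maximises \<open>\<Phi>\<close> over
  this product, with maximum \<open>S\<close>. Moving the component \<open>U j\<close> linearly towards some \<open>v \<in> K j\<close> cannot
  increase \<open>\<Phi>\<close>, and the derivative at the starting point says \<open>\<integral> G(U)\<^sup>q v / U j \<le> S\<close>. So
  \<open>g j = S powr (1/q - 1) * G(U)\<^sup>q / U j\<close> satisfies \<open>\<integral> g j * v \<le> S powr (1/q) \<le> A\<close>, while
  \<open>G(g) = S powr (1/q - 1) * G(U) powr (q - 1)\<close>, whose power with exponent \<open>q/(q-1)\<close> is \<open>G(U)\<^sup>q / S\<close>,
  a function of integral 1.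

  The maximum need not be attained on the product itself, only at an almost everywhere limit of
  tuples. Such a limit is enough, since the competitors in the variation are limits of admissible
  tuples too and Fatou's lemma bounds their energy by \<open>S\<close> (\<open>integrand_limit_le_max\<close>). Four points
  make this work; the last three use \<open>q < 1\<close> or saturation.

  First, some maximising sequence converges almost everywhere
  (\<open>exists_AE_convergent_maximising_sequence\<close>). Since \<open>\<Phi>\<close> is concave, its superlevel sets are
  convex, and near the top of \<open>\<Phi>\<close> one picks tuples that almost minimise \<open>\<Sum>j. \<integral> \<rho> exp (- u j)\<close> for an
  integrable weight \<open>\<rho> > 0\<close>. The defect of midpoint convexity of \<open>exp\<close> is a perfect square, so
  the functions \<open>exp (- u j / 2)\<close> are Cauchy in the weighted \<open>L\<^sup>2\<close> space.

  Secondly, the limit is finite (\<open>AE_limit_finite\<close>): if a component tended to infinity on a set of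
  positive measure, averaging with a saturating tuple would produce infinite energy.

  Thirdly, no energy is lost in the limit (\<open>powr_midpoint_no_mass_loss\<close>). Two separated portions of
  mass \<open>\<delta>\<close> contribute \<open>2 * 2 powr (- q) * \<delta> > \<delta>\<close> to the energy of the midpoint, which would then
  exceed the supremum.

  Finally, the maximiser is positive almost everywhere (\<open>maximiser_positive\<close>): if \<open>G(U)\<close> vanished on
  a set of positive measure, mixing in a proportion \<open>t\<close> of a saturating tuple would cost energy of
  order \<open>t\<close> and gain energy of order \<open>t powr q\<close>.
\<close>

section \<open>Real powers and almost everywhere convergence\<close>

text \<open>Convexity on the closed half-line; the endpoint 0 is outside the scope of the derivative
  criterion behind \<open>powr_convex\<close>.\<close>

lemma powr_convex_combination:
  fixes x y r t :: real
  assumes "1 \<le> r" "0 \<le> x" "0 \<le> y" "0 \<le> t" "t \<le> 1"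
  shows "((1 - t) * x + t * y) powr r \<le> (1 - t) * x powr r + t * y powr r"
proof -
  have scale: "(s * z) powr r \<le> s * z powr r" if "0 \<le> s" "s \<le> 1" "0 \<le> z" for s z :: real
  proof -
    have "s powr r \<le> s" using powr_mono'[of 1 r s] that assms(1) by simp
    then show ?thesis using that by (simp add: powr_mult mult_right_mono)
  qed
  consider "x = 0" | "y = 0" | "0 < x" "0 < y" using assms by linarith
  then show ?thesis
  proof cases
    case 3
    then show ?thesis using convex_onD[OF powr_convex[OF assms(1)], of t x y] assms by simp
  qed (use scale[of t y] scale[of "1 - t" x] assms in auto)
qed

lemma midpoint_powr_concave:
  fixes x y q :: real
  assumes "0 \<le> x" "0 \<le> y" "0 < q" "q < 1"
  shows "(x powr q + y powr q) / 2 \<le> ((x + y) / 2) powr q"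
proof -
  have "((x powr q + y powr q) / 2) powr (1/q) \<le> (x + y) / 2"
    using powr_convex_combination[of "1/q" "x powr q" "y powr q" "1/2"] assms
    by (simp add: powr_powr add_divide_distrib)
  then have "(((x powr q + y powr q) / 2) powr (1/q)) powr q \<le> ((x + y) / 2) powr q"
    using assms by (intro powr_mono2) auto
  then show ?thesis
    using assms by (simp add: powr_powr)
qed

lemma powr_at_top_at_top:
  fixes s :: real
  assumes "0 < s"
  shows "filterlim (\<lambda>x. x powr s) at_top at_top"
proof -
  have "filterlim (\<lambda>x. exp (s * ln x)) at_top at_top"
    by (rule filterlim_compose[OF exp_at_top], rule filterlim_tendsto_pos_mult_at_top,
        rule tendsto_const, rule assms, rule ln_at_top)
  moreover have "eventually (\<lambda>x. exp (s * ln x) = x powr s) at_top"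
    using eventually_gt_at_top[of 0] by eventually_elim (simp add: powr_def)
  ultimately show ?thesis
    by (simp add: filterlim_cong[OF refl refl])
qed

text \<open>Brings the almost everywhere claims below into the form in which saturation applies: a
  set of positive measure on which the claim fails.\<close>

lemma AE_if_no_positive_counterset:
  assumes P: "Measurable.pred M P"
    and contra: "\<And>E. E \<in> sets M \<Longrightarrow> 0 < emeasure M E \<Longrightarrow> \<forall>x\<in>E. \<not> P x \<Longrightarrow> False"
  shows "AE x in M. P x"
proof -
  define N where "N = {x \<in> space M. \<not> P x}"
  have N: "N \<in> sets M" unfolding N_def by (rule sets.sets_Collect_neg[OF predE[OF P]])
  have "\<forall>x\<in>N. \<not> P x" by (simp add: N_def)
  then have "\<not> 0 < emeasure M N" using contra[OF N] by iprover
  then have "emeasure M N = 0" by simp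
  then show ?thesis by (simp only: AE_iff_measurable[OF N N_def[symmetric]])
qed

text \<open>One subsequence for all indices at once, by successive extraction.\<close>

lemma finite_family_AE_Cauchy_subseq:
  fixes s :: "'i \<Rightarrow> nat \<Rightarrow> 'a \<Rightarrow> real"
  assumes "finite I"
    and "\<And>i n. i \<in> I \<Longrightarrow> integrable M (s i n)"
    and "\<And>i e. i \<in> I \<Longrightarrow> 0 < e \<Longrightarrow> \<exists>N. \<forall>n\<ge>N. \<forall>m\<ge>N. (\<integral>x. \<bar>s i n x - s i m x\<bar> \<partial>M) < e"
  shows "\<exists>r. strict_mono r \<and> (\<forall>i\<in>I. AE x in M. Cauchy (\<lambda>n. s i (r n) x))"
  using assms
proof (induction I)
  case empty
  show ?case by (auto intro: exI[of _ id] strict_mono_id)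
next
  case (insert j I)
  then obtain r where r: "strict_mono r" "\<forall>i\<in>I. AE x in M. Cauchy (\<lambda>n. s i (r n) x)"
    by fastforce
  have "\<exists>N. \<forall>n\<ge>N. \<forall>m\<ge>N. (\<integral>x. norm (s j (r n) x - s j (r m) x) \<partial>M) < e" if e: "0 < e" for e
  proof -
    obtain N where N: "\<forall>n\<ge>N. \<forall>m\<ge>N. (\<integral>x. \<bar>s j n x - s j m x\<bar> \<partial>M) < e"
      using insert.prems(2)[OF insertI1 e] by blast
    have "N \<le> r n" if "N \<le> n" for n using seq_suble[OF r(1), of n] that by simp
    with N show ?thesis by auto
  qed
  then obtain r' where r': "strict_mono r'" "AE x in M. Cauchy (\<lambda>n. s j (r (r' n)) x)"
    using cauchy_L1_AE_cauchy_subseq[of M "\<lambda>n. s j (r n)"] insert.prems(1) by blast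
  have "AE x in M. Cauchy (\<lambda>n. s i (r (r' n)) x)" if "i \<in> I" for i
    using r(2)[rule_format, OF that]
  proof (eventually_elim)
    case (elim x)
    from Cauchy_subseq_Cauchy[OF elim r'(1)] show ?case by (simp add: o_def)
  qed
  moreover have "strict_mono (\<lambda>n. r (r' n))" using strict_mono_o[OF r(1) r'(1)] by (simp add: comp_def)
  moreover have "AE x in M. Cauchy (\<lambda>n. s i (r (r' n)) x)" if "i \<in> insert j I" for i
    using that r'(2) calculation(1) by (cases "i = j") blast+
  ultimately show ?case by blast
qed

text \<open>Mass that escapes from the sequence would show up twice, in \<open>b n\<close> and in \<open>b m\<close>, and the power
  \<open>q < 1\<close> rewards spreading: where \<open>b n\<close> is negligible, the midpoint keeps the fraction
  \<open>2 powr (- q) > 1/2\<close> of \<open>b m powr q\<close>. So the gap between the midpoint integrand and the average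
  controls \<open>b m powr q\<close> wherever it exceeds a multiple of \<open>b n powr q\<close>. The gap has small integral,
  since the averages are almost as large as \<open>S\<close>; the rest is dominated by an integrable function.\<close>

lemma powr_midpoint_no_mass_loss:
  fixes b :: "nat \<Rightarrow> 'a \<Rightarrow> real" and a :: "'a \<Rightarrow> real"
  assumes q: "0 < q" "q < 1"
    and meas[measurable]: "\<And>n. b n \<in> borel_measurable M" "a \<in> borel_measurable M"
    and nonneg: "\<And>n x. 0 \<le> b n x"
    and lim: "AE x in M. (\<lambda>n. b n x) \<longlonglongrightarrow> a x"
    and int: "\<And>n. integrable M (\<lambda>x. b n x powr q)"
    and mid_int: "\<And>n m. integrable M (\<lambda>x. ((b n x + b m x) / 2) powr q)"
    and mid_le: "\<And>n m. (\<integral>x. ((b n x + b m x) / 2) powr q \<partial>M) \<le> S"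
    and conv: "(\<lambda>n. \<integral>x. b n x powr q \<partial>M) \<longlonglongrightarrow> S"
  shows "ennreal S \<le> (\<integral>\<^sup>+x. ennreal (a x powr q) \<partial>M)"
proof -
  define \<kappa> where "\<kappa> = (1/2) powr q - (1/2::real)"
  have "(1/2::real) powr 1 < (1/2) powr q" using q by (intro powr_less_mono') auto
  then have \<kappa>: "0 < \<kappa>" unfolding \<kappa>_def by simp
  define C where "C = 1 / (2 * \<kappa>)"
  have C: "0 < C" using \<kappa> by (simp add: C_def)
  have limq: "AE x in M. (\<lambda>n. b n x powr q) \<longlonglongrightarrow> a x powr q"
    using lim
  proof eventually_elim
    case (elim x)
    show ?case
      by (rule tendsto_powr'[OF elim tendsto_const]) (use q nonneg in auto)
  qed
  have step: "ennreal S \<le> (\<integral>\<^sup>+x. ennreal (a x powr q) \<partial>M) + ennreal (\<epsilon> / \<kappa>)" if \<epsilon>: "0 < \<epsilon>" for \<epsilon>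
  proof -
    obtain N where N: "\<And>n. n \<ge> N \<Longrightarrow> S - \<epsilon> < (\<integral>x. b n x powr q \<partial>M)"
      using order_tendstoD(1)[OF conv, of "S - \<epsilon>"] \<epsilon> by (auto simp: eventually_sequentially)
    define g where "g m x = ((b N x + b m x) / 2) powr q - (b N x powr q + b m x powr q) / 2" for m x
    have g_int: "integrable M (g m)" for m
      unfolding g_def by (intro Bochner_Integration.integrable_diff Bochner_Integration.integrable_add
          integrable_divide int mid_int)
    have g0: "0 \<le> g m x" for m x
      using midpoint_powr_concave[of "b N x" "b m x" q] q nonneg by (simp add: g_def)
    have gle: "(\<integral>x. g m x \<partial>M) \<le> \<epsilon>" if "m \<ge> N" for m
    proof -
      have "(\<integral>x. g m x \<partial>M) = (\<integral>x. ((b N x + b m x) / 2) powr q \<partial>M)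
          - ((\<integral>x. b N x powr q \<partial>M) + (\<integral>x. b m x powr q \<partial>M)) / 2"
        unfolding g_def using int mid_int by simp
      then show ?thesis using mid_le[of N m] N[OF order_refl] N[OF that] by (simp add: field_simps)
    qed
    \<comment> \<open>The dominated part of \<open>b m powr q\<close>; the excess over it is at most \<open>g m / \<kappa>\<close>.\<close>
    define k where "k m x = min (b m x powr q) (C * b N x powr q)" for m x
    have k_int: "integrable M (k m)" for m
      unfolding k_def by (intro integrable_min integrable_mult_right int)
    have split: "b m x powr q \<le> k m x + g m x / \<kappa>" for m x
    proof -
      have "(1/2) powr q * b m x powr q = (b m x / 2) powr q"
        using nonneg by (simp add: powr_divide)
      also have "\<dots> \<le> ((b N x + b m x) / 2) powr q"
        using nonneg q by (intro powr_mono2) auto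
      finally have "\<kappa> * b m x powr q \<le> g m x + b N x powr q / 2"
        unfolding g_def \<kappa>_def add_divide_distrib left_diff_distrib by linarith
      then have "b m x powr q \<le> (g m x + b N x powr q / 2) / \<kappa>"
        using \<kappa> by (simp add: field_simps)
      then have "b m x powr q \<le> g m x / \<kappa> + C * b N x powr q"
        by (simp add: C_def add_divide_distrib)
      moreover have "0 \<le> g m x / \<kappa>" using g0 \<kappa> by simp
      ultimately show ?thesis unfolding k_def by (simp add: min_def)
    qed
    have ineq: "(\<integral>x. b m x powr q \<partial>M) \<le> (\<integral>x. k m x \<partial>M) + \<epsilon> / \<kappa>" if "m \<ge> N" for m
    proof -
      have "(\<integral>x. b m x powr q \<partial>M) \<le> (\<integral>x. k m x + g m x / \<kappa> \<partial>M)"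
        by (intro integral_mono int Bochner_Integration.integrable_add k_int integrable_divide g_int split)
      also have "\<dots> = (\<integral>x. k m x \<partial>M) + (\<integral>x. g m x \<partial>M) / \<kappa>"
        using k_int g_int by simp
      also have "\<dots> \<le> (\<integral>x. k m x \<partial>M) + \<epsilon> / \<kappa>"
        using gle[OF that] \<kappa> by (simp add: divide_right_mono)
      finally show ?thesis .
    qed
    define k' where "k' x = min (a x powr q) (C * b N x powr q)" for x
    have k'_meas[measurable]: "k' \<in> borel_measurable M" unfolding k'_def by measurable
    have k_lim: "AE x in M. (\<lambda>m. k m x) \<longlonglongrightarrow> k' x"
      using limq
    proof eventually_elim
      case (elim x)
      then show ?case unfolding k_def k'_def by (intro tendsto_min tendsto_const)
    qed
    have dom: "AE x in M. norm (k m x) \<le> C * b N x powr q" for m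
      unfolding k_def using C by (auto simp: min_def)
    have Cint: "integrable M (\<lambda>x. C * b N x powr q)" by (intro integrable_mult_right int)
    have kmeas: "\<And>m. k m \<in> borel_measurable M" using k_int by auto
    have k'_int: "integrable M k'"
      by (rule integrable_dominated_convergence[OF k'_meas kmeas Cint k_lim dom])
    have lim_int: "(\<lambda>m. \<integral>x. k m x \<partial>M) \<longlonglongrightarrow> (\<integral>x. k' x \<partial>M)"
      by (rule integral_dominated_convergence[OF k'_meas kmeas Cint k_lim dom])
    have "S \<le> (\<integral>x. k' x \<partial>M) + \<epsilon> / \<kappa>"
      by (rule tendsto_le[OF sequentially_bot tendsto_add[OF lim_int tendsto_const] conv])
         (use ineq in \<open>auto simp: eventually_sequentially\<close>)
    then have "ennreal S \<le> ennreal ((\<integral>x. k' x \<partial>M) + \<epsilon> / \<kappa>)" by (rule ennreal_leI)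
    also have "\<dots> = ennreal (\<integral>x. k' x \<partial>M) + ennreal (\<epsilon> / \<kappa>)"
      using \<epsilon> \<kappa> C by (intro ennreal_plus integral_nonneg_AE) (auto simp: k'_def)
    also have "ennreal (\<integral>x. k' x \<partial>M) = (\<integral>\<^sup>+x. ennreal (k' x) \<partial>M)"
      using C by (intro nn_integral_eq_integral[symmetric] k'_int) (auto simp: k'_def)
    also have "\<dots> \<le> (\<integral>\<^sup>+x. ennreal (a x powr q) \<partial>M)"
      by (intro nn_integral_mono ennreal_leI) (simp add: k'_def)
    finally show ?thesis by (simp add: add_right_mono)
  qed
  show ?thesis
  proof (rule ennreal_le_epsilon)
    fix e :: real assume "0 < e"
    then show "ennreal S \<le> (\<integral>\<^sup>+x. ennreal (a x powr q) \<partial>M) + ennreal e"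
      using step[of "e * \<kappa>"] \<kappa> by simp
  qed
qed

section \<open>Weighted geometric means\<close>

definition geometric_mean :: "'i set \<Rightarrow> ('i \<Rightarrow> real) \<Rightarrow> ('i \<Rightarrow> real) \<Rightarrow> real" where
  "geometric_mean I \<alpha> a = (\<Prod>i\<in>I. a i powr \<alpha> i)"

locale weights =
  fixes I :: "'i set" and \<alpha> :: "'i \<Rightarrow> real"
  assumes finite_I: "finite I"
    and weight_pos: "i \<in> I \<Longrightarrow> 0 < \<alpha> i"
    and weight_sum: "(\<Sum>i\<in>I. \<alpha> i) = 1"
begin

abbreviation gmean :: "('i \<Rightarrow> real) \<Rightarrow> real" where
  "gmean \<equiv> geometric_mean I \<alpha>"

lemma gmean_nonneg: "0 \<le> gmean a"
  by (simp add: geometric_mean_def prod_nonneg)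

lemma gmean_pos:
  assumes "\<And>i. i \<in> I \<Longrightarrow> 0 < a i"
  shows "0 < gmean a"
  unfolding geometric_mean_def by (rule prod_pos) (use assms in force)

lemma gmean_eq_0:
  assumes "i \<in> I" "a i = 0"
  shows "gmean a = 0"
  unfolding geometric_mean_def using assms finite_I by (auto intro!: prod_zero)

lemma gmean_cong:
  assumes "\<And>i. i \<in> I \<Longrightarrow> a i = b i"
  shows "gmean a = gmean b"
  unfolding geometric_mean_def using assms by (auto intro!: prod.cong)

lemma gmean_mono:
  assumes "\<And>i. i \<in> I \<Longrightarrow> 0 \<le> a i" "\<And>i. i \<in> I \<Longrightarrow> a i \<le> b i"
  shows "gmean a \<le> gmean b"
  unfolding geometric_mean_def
  by (rule prod_mono) (use assms weight_pos in \<open>auto intro!: powr_mono2 simp: less_imp_le\<close>)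

lemma gmean_scale:
  assumes "0 \<le> c" "\<And>i. i \<in> I \<Longrightarrow> 0 \<le> a i"
  shows "gmean (\<lambda>i. c * a i) = c * gmean a"
proof -
  have "(\<Prod>i\<in>I. c powr \<alpha> i) = c"
  proof (cases "c = 0")
    case True
    have "I \<noteq> {}" using weight_sum by auto
    then show ?thesis using True finite_I by (simp add: card_gt_0_iff)
  next
    case False
    then show ?thesis using assms(1) weight_sum by (simp add: powr_sum[symmetric] finite_I)
  qed
  then show ?thesis
    using assms by (simp add: geometric_mean_def powr_mult prod.distrib)
qed

lemma gmean_divide:
  assumes "\<And>i. i \<in> I \<Longrightarrow> 0 \<le> a i" "\<And>i. i \<in> I \<Longrightarrow> 0 < b i"
  shows "gmean (\<lambda>i. a i / b i) = gmean a / gmean b"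
  unfolding geometric_mean_def prod_dividef[symmetric]
  by (rule prod.cong) (use assms in \<open>auto simp: powr_divide less_imp_le\<close>)

lemma gmean_le_weighted_sum:
  assumes "\<And>i. i \<in> I \<Longrightarrow> 0 < a i"
  shows "gmean a \<le> (\<Sum>i\<in>I. \<alpha> i * a i)"
proof -
  have ne: "I \<noteq> {}" using weight_sum by auto
  have pos: "0 < (\<Sum>i\<in>I. \<alpha> i * a i)"
    using assms weight_pos finite_I ne by (intro sum_pos) auto
  have "(\<Sum>i\<in>I. \<alpha> i * ln (a i)) \<le> ln (\<Sum>i\<in>I. \<alpha> i *\<^sub>R a i)"
    by (rule concave_on_sum[OF finite_I ne ln_concave])
       (use assms weight_pos weight_sum in \<open>auto simp: less_imp_le\<close>)
  then have "exp (\<Sum>i\<in>I. \<alpha> i * ln (a i)) \<le> (\<Sum>i\<in>I. \<alpha> i * a i)"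
    using pos by (simp add: ln_ge_iff)
  moreover have "exp (\<Sum>i\<in>I. \<alpha> i * ln (a i)) = gmean a"
    unfolding geometric_mean_def exp_sum[OF finite_I]
    by (rule prod.cong) (use assms in \<open>auto simp: powr_def less_imp_neq[symmetric]\<close>)
  ultimately show ?thesis by simp
qed

text \<open>Minkowski's inequality for geometric means: divide by the right-hand side and apply the
  weighted inequality of the arithmetic and geometric means to the ratios \<open>a i / (a i + b i)\<close> and
  \<open>b i / (a i + b i)\<close>, which add up to 1 for each \<open>i\<close>.\<close>

lemma gmean_superadditive:
  assumes a: "\<And>i. i \<in> I \<Longrightarrow> 0 \<le> a i" and b: "\<And>i. i \<in> I \<Longrightarrow> 0 \<le> b i"
  shows "gmean a + gmean b \<le> gmean (\<lambda>i. a i + b i)"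
proof (cases "gmean a = 0 \<or> gmean b = 0")
  case True
  then show ?thesis
    using gmean_mono[of a "\<lambda>i. a i + b i"] gmean_mono[of b "\<lambda>i. a i + b i"] a b by auto
next
  case False
  have pa: "0 < a i" and pb: "0 < b i" if "i \<in> I" for i
    using that a b False gmean_eq_0[of i] by (metis less_eq_real_def)+
  let ?s = "\<lambda>i. a i + b i"
  have G: "0 < gmean ?s" by (rule gmean_pos) (use pa pb in \<open>simp add: add_pos_pos\<close>)
  have "gmean a / gmean ?s + gmean b / gmean ?s
      = gmean (\<lambda>i. a i / ?s i) + gmean (\<lambda>i. b i / ?s i)"
    using pa pb by (simp add: gmean_divide add_pos_pos less_imp_le)
  also have "\<dots> \<le> (\<Sum>i\<in>I. \<alpha> i * (a i / ?s i)) + (\<Sum>i\<in>I. \<alpha> i * (b i / ?s i))"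
    by (intro add_mono gmean_le_weighted_sum) (use pa pb in \<open>simp_all add: add_pos_pos\<close>)
  also have "\<dots> = (\<Sum>i\<in>I. \<alpha> i * ((a i + b i) / ?s i))"
    unfolding sum.distrib[symmetric] add_divide_distrib distrib_left ..
  also have "\<dots> = (\<Sum>i\<in>I. \<alpha> i)"
    by (rule sum.cong) (use pa pb in \<open>fastforce simp: add_pos_pos\<close>)+
  finally show ?thesis using G weight_sum by (simp add: add_divide_distrib[symmetric])
qed

lemma gmean_concave:
  assumes "\<And>i. i \<in> I \<Longrightarrow> 0 \<le> a i" "\<And>i. i \<in> I \<Longrightarrow> 0 \<le> b i" "0 \<le> t" "t \<le> 1"
  shows "(1 - t) * gmean a + t * gmean b \<le> gmean (\<lambda>i. (1 - t) * a i + t * b i)"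
  using gmean_superadditive[of "\<lambda>i. (1 - t) * a i" "\<lambda>i. t * b i"] assms
  by (simp add: gmean_scale)

text \<open>For variations of a single component.\<close>

lemma gmean_fun_upd:
  assumes "j \<in> I" "0 \<le> c" "0 \<le> a j"
  shows "gmean (a(j := c * a j)) = c powr \<alpha> j * gmean a"
proof -
  have "gmean (a(j := c * a j)) = (\<Prod>i\<in>I. (if i = j then c powr \<alpha> j else 1) * a i powr \<alpha> i)"
    unfolding geometric_mean_def by (rule prod.cong) (use assms in \<open>auto simp: powr_mult\<close>)
  also have "\<dots> = c powr \<alpha> j * gmean a"
    unfolding prod.distrib geometric_mean_def using assms finite_I by (simp add: prod.delta)
  finally show ?thesis .
qed

lemma tendsto_gmean:
  assumes "\<And>i. i \<in> I \<Longrightarrow> ((\<lambda>n. a n i) \<longlongrightarrow> l i) F" "\<And>i n. i \<in> I \<Longrightarrow> 0 \<le> a n i"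
  shows "((\<lambda>n. gmean (a n)) \<longlongrightarrow> gmean l) F"
  unfolding geometric_mean_def
  by (intro tendsto_prod tendsto_powr' tendsto_const assms) (use assms weight_pos in auto)

end

section \<open>The energy of a saturating family of convex sets\<close>

text \<open>The abstract setting of the maximisation. The members of \<open>K i\<close> are functions that are
  nonnegative everywhere, rather than classes modulo null sets; this way convexity is a pointwise
  matter.\<close>

locale saturating_family = weights I \<alpha> + sigma_finite_measure M
  for I :: "'i set" and \<alpha> :: "'i \<Rightarrow> real" and M :: "'a measure" +
  fixes K :: "'i \<Rightarrow> ('a \<Rightarrow> real) set" and q B :: real
  assumes space_not_null: "emeasure M (space M) \<noteq> 0"
    and q_pos: "0 < q" and q_less_1: "q < 1"
    and K_measurable: "i \<in> I \<Longrightarrow> v \<in> K i \<Longrightarrow> v \<in> borel_measurable M"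
    and K_nonneg: "i \<in> I \<Longrightarrow> v \<in> K i \<Longrightarrow> 0 \<le> v x"
    and K_convex: "i \<in> I \<Longrightarrow> v \<in> K i \<Longrightarrow> w \<in> K i \<Longrightarrow> 0 \<le> t \<Longrightarrow> t \<le> 1 \<Longrightarrow>
          (\<lambda>x. (1 - t) * v x + t * w x) \<in> K i"
    and K_saturates: "i \<in> I \<Longrightarrow> E \<in> sets M \<Longrightarrow> 0 < emeasure M E \<Longrightarrow>
          \<exists>E'\<in>sets M. E' \<subseteq> E \<and> 0 < emeasure M E' \<and> (\<exists>h\<in>K i. \<forall>x\<in>E'. 0 < h x)"
    and K_bounded: "(\<And>i. i \<in> I \<Longrightarrow> u i \<in> K i) \<Longrightarrow>
          (\<integral>\<^sup>+x. ennreal (geometric_mean I \<alpha> (\<lambda>i. u i x) powr q) \<partial>M) \<le> ennreal B"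
begin

definition tuples :: "('i \<Rightarrow> 'a \<Rightarrow> real) set" where
  "tuples = {u. \<forall>i\<in>I. u i \<in> K i}"

definition integrand :: "('i \<Rightarrow> 'a \<Rightarrow> real) \<Rightarrow> 'a \<Rightarrow> real" where
  "integrand u x = gmean (\<lambda>i. u i x) powr q"

definition energy :: "('i \<Rightarrow> 'a \<Rightarrow> real) \<Rightarrow> real" where
  "energy u = (\<integral>x. integrand u x \<partial>M)"

definition max_energy :: real where
  "max_energy = (SUP u\<in>tuples. energy u)"

definition mix :: "real \<Rightarrow> ('i \<Rightarrow> 'a \<Rightarrow> real) \<Rightarrow> ('i \<Rightarrow> 'a \<Rightarrow> real) \<Rightarrow> 'i \<Rightarrow> 'a \<Rightarrow> real" where
  "mix t u v = (\<lambda>i x. (1 - t) * u i x + t * v i x)"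

lemma tuples_measurable: "u \<in> tuples \<Longrightarrow> i \<in> I \<Longrightarrow> u i \<in> borel_measurable M"
  using K_measurable by (auto simp: tuples_def)

lemma tuples_nonneg: "u \<in> tuples \<Longrightarrow> i \<in> I \<Longrightarrow> 0 \<le> u i x"
  using K_nonneg by (auto simp: tuples_def)

lemma mix_in_tuples: "u \<in> tuples \<Longrightarrow> v \<in> tuples \<Longrightarrow> 0 \<le> t \<Longrightarrow> t \<le> 1 \<Longrightarrow> mix t u v \<in> tuples"
  using K_convex by (auto simp: tuples_def mix_def)

lemma gmean_measurable:
  "(\<And>i. i \<in> I \<Longrightarrow> u i \<in> borel_measurable M) \<Longrightarrow> (\<lambda>x. gmean (\<lambda>i. u i x)) \<in> borel_measurable M"
  unfolding geometric_mean_def by (intro borel_measurable_prod powr_real_measurable borel_measurable_const) auto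

lemma integrand_measurable:
  "(\<And>i. i \<in> I \<Longrightarrow> u i \<in> borel_measurable M) \<Longrightarrow> integrand u \<in> borel_measurable M"
  unfolding integrand_def[abs_def] by (intro powr_real_measurable borel_measurable_const gmean_measurable) auto

lemma integrand_nonneg: "0 \<le> integrand u x"
  by (simp add: integrand_def)

lemma integrable_integrand: "u \<in> tuples \<Longrightarrow> integrable M (integrand u)"
  using K_bounded[of u]
  by (intro integrableI_nonneg integrand_measurable tuples_measurable)
     (auto simp: integrand_def tuples_def intro: le_less_trans)

lemma nn_integral_integrand: "u \<in> tuples \<Longrightarrow> (\<integral>\<^sup>+x. ennreal (integrand u x) \<partial>M) = ennreal (energy u)"
  unfolding energy_def by (intro nn_integral_eq_integral integrable_integrand AE_I2 integrand_nonneg)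

lemma energy_nonneg: "0 \<le> energy u"
  unfolding energy_def by (intro integral_nonneg_AE AE_I2 integrand_nonneg)

lemma energy_le_max:
  assumes "u \<in> tuples"
  shows "energy u \<le> max_energy"
proof -
  have "energy v \<le> max 0 B" if "v \<in> tuples" for v
  proof -
    have "ennreal (energy v) \<le> ennreal B"
      using K_bounded[of v] nn_integral_integrand[OF that] that by (simp add: tuples_def integrand_def)
    then show ?thesis using energy_nonneg[of v] by (metis ennreal_le_iff2 le_max_iff_disj order_trans)
  qed
  then have "bdd_above (energy ` tuples)" by (auto intro!: bdd_aboveI2)
  with assms show ?thesis unfolding max_energy_def by (rule cSUP_upper)
qed

lemma integrand_mix:
  assumes "u \<in> tuples" "v \<in> tuples" "0 \<le> t" "t \<le> 1"
  shows "((1 - t) * gmean (\<lambda>i. u i x) + t * gmean (\<lambda>i. v i x)) powr q \<le> integrand (mix t u v) x"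
  unfolding integrand_def mix_def
  using assms q_pos gmean_nonneg
  by (intro powr_mono2 gmean_concave) (auto simp: tuples_nonneg)

text \<open>Concavity of the energy combines two facts: the geometric mean is concave, and \<open>t powr q\<close> is
  increasing and concave.\<close>

lemma energy_midpoint:
  assumes "u \<in> tuples" "v \<in> tuples"
  shows "(energy u + energy v) / 2 \<le> energy (mix (1/2) u v)"
proof -
  have "(integrand u x + integrand v x) / 2 \<le> integrand (mix (1/2) u v) x" for x
    using integrand_mix[OF assms, of "1/2" x]
      midpoint_powr_concave[OF gmean_nonneg gmean_nonneg q_pos q_less_1, of "\<lambda>i. u i x" "\<lambda>i. v i x"]
    by (simp add: integrand_def add_divide_distrib)
  then have "(\<integral>x. (integrand u x + integrand v x) / 2 \<partial>M) \<le> energy (mix (1/2) u v)"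
    unfolding energy_def using assms
    by (intro integral_mono integrable_divide Bochner_Integration.integrable_add integrable_integrand mix_in_tuples) auto
  then show ?thesis using assms integrable_integrand by (simp add: energy_def)
qed

text \<open>Shrinking the set once for each index makes all components positive on a common set.\<close>

lemma saturating_tuple:
  assumes "E \<in> sets M" "0 < emeasure M E"
  obtains E' h where "E' \<in> sets M" "E' \<subseteq> E" "0 < emeasure M E'" "h \<in> tuples"
    "\<And>i x. i \<in> I \<Longrightarrow> x \<in> E' \<Longrightarrow> 0 < h i x"
proof -
  have "\<exists>E'\<in>sets M. E' \<subseteq> E \<and> 0 < emeasure M E' \<and> (\<exists>h. \<forall>i\<in>J. h i \<in> K i \<and> (\<forall>x\<in>E'. 0 < h i x))"
    if "finite J" "J \<subseteq> I" for J
    using that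
  proof (induction J)
    case empty
    then show ?case using assms by blast
  next
    case (insert j J)
    then obtain E' h where E': "E' \<in> sets M" "E' \<subseteq> E" "0 < emeasure M E'"
      "\<forall>i\<in>J. h i \<in> K i \<and> (\<forall>x\<in>E'. 0 < h i x)"
      by auto
    obtain E'' k where E'': "E'' \<in> sets M" "E'' \<subseteq> E'" "0 < emeasure M E''"
      "k \<in> K j" "\<forall>x\<in>E''. 0 < k x"
      using K_saturates[OF _ E'(1,3), of j] insert.prems by blast
    show ?case
    proof (intro bexI[of _ E''] conjI exI[of _ "h(j := k)"] ballI)
      fix i assume "i \<in> insert j J"
      then show "(h(j := k)) i \<in> K i" using E'(4) E''(4) by auto
      fix x assume "x \<in> E''"
      then show "0 < (h(j := k)) i x" using E'(4) E''(2,5) \<open>i \<in> insert j J\<close> by auto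
    qed (use E' E'' in auto)
  qed
  from this[OF finite_I subset_refl] show ?thesis
    using that unfolding tuples_def by blast
qed

lemma energy_pos_if_pos_on:
  assumes "h \<in> tuples" "E \<in> sets M" "0 < emeasure M E"
    "\<And>i x. i \<in> I \<Longrightarrow> x \<in> E \<Longrightarrow> 0 < h i x"
  shows "0 < (\<integral>x. integrand h x * indicator E x \<partial>M)"
proof -
  have int: "integrable M (\<lambda>x. integrand h x * indicator E x)"
    using assms by (intro integrable_real_mult_indicator integrable_integrand)
  have "(\<integral>x. integrand h x * indicator E x \<partial>M) \<noteq> 0"
  proof
    assume "(\<integral>x. integrand h x * indicator E x \<partial>M) = 0"
    then have "AE x in M. integrand h x * indicator E x = 0"
      using integral_nonneg_eq_0_iff_AE[OF int] integrand_nonneg by auto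
    then have "AE x in M. x \<notin> E"
    proof eventually_elim
      case (elim x)
      have "0 < integrand h x" if "x \<in> E"
        using gmean_pos[of "\<lambda>i. h i x"] assms(4) that by (simp add: integrand_def)
      with elim show ?case by (auto simp: indicator_def)
    qed
    then have "emeasure M E = 0"
      using AE_iff_measurable[OF assms(2), of "\<lambda>x. x \<notin> E"] sets.sets_into_space[OF assms(2)] by auto
    with assms(3) show False by simp
  qed
  moreover have "0 \<le> (\<integral>x. integrand h x * indicator E x \<partial>M)"
    by (intro integral_nonneg_AE AE_I2 mult_nonneg_nonneg integrand_nonneg) auto
  ultimately show ?thesis by simp
qed

lemma max_energy_pos: "0 < max_energy" and tuples_nonempty: "tuples \<noteq> {}"
proof -
  obtain E h where E: "E \<in> sets M" "0 < emeasure M E" "h \<in> tuples"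
    "\<And>i x. i \<in> I \<Longrightarrow> x \<in> E \<Longrightarrow> 0 < h i x"
    by (rule saturating_tuple[OF sets.top])
       (use space_not_null in \<open>auto simp: zero_less_iff_neq_zero\<close>)
  then show "tuples \<noteq> {}" by blast
  have "0 < (\<integral>x. integrand h x * indicator E x \<partial>M)"
    using E by (intro energy_pos_if_pos_on)
  also have "\<dots> \<le> energy h"
    unfolding energy_def using E integrand_nonneg
    by (intro integral_mono integrable_real_mult_indicator integrable_integrand) (auto simp: indicator_def)
  also have "\<dots> \<le> max_energy" using E(3) by (rule energy_le_max)
  finally show "0 < max_energy" .
qed

lemma max_energy_le_bound:
  assumes "0 \<le> B"
  shows "max_energy \<le> B"
  unfolding max_energy_def
proof (rule cSUP_least[OF tuples_nonempty])
  fix v assume v: "v \<in> tuples"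
  then have "ennreal (energy v) \<le> ennreal B"
    using K_bounded[of v] nn_integral_integrand[OF v] by (simp add: tuples_def integrand_def)
  then show "energy v \<le> B" using assms by (simp add: ennreal_le_iff)
qed

section \<open>Existence of a maximiser\<close>

text \<open>Bounds on the energy give no compactness for the functions \<open>u n i\<close>, which may be unbounded.
  The auxiliary functional \<open>J\<close> below is finite, and strictly convex. Minimising it over the
  superlevel sets \<open>C n\<close> of the energy selects tuples that get close to each other: for \<open>n \<le> m\<close> the
  midpoint of \<open>u n\<close> and \<open>u m\<close> lies in \<open>C n\<close>, so \<open>J\<close> there is at least the infimum \<open>j n\<close>,
  while \<open>J (u n)\<close> and \<open>J (u m)\<close> are almost \<open>j n\<close> and \<open>j m\<close>, and \<open>j\<close> converges. The limit is stated
  for \<open>exp (- u n i / 2)\<close>, because at this stage \<open>u n i\<close> itself may still tend to infinity.\<close>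

lemma exists_AE_convergent_maximising_sequence:
  obtains u w where "\<And>n. u n \<in> tuples" "(\<lambda>n. energy (u n)) \<longlonglongrightarrow> max_energy"
    "\<And>i. i \<in> I \<Longrightarrow> w i \<in> borel_measurable M"
    "\<And>i. i \<in> I \<Longrightarrow> AE x in M. (\<lambda>n. exp (- u n i x / 2)) \<longlonglongrightarrow> w i x"
proof -
  obtain \<rho> :: "'a \<Rightarrow> real" where \<rho>[measurable]: "\<rho> \<in> borel_measurable M"
    and \<rho>_pos: "\<And>x. 0 < \<rho> x" and \<rho>_int: "integrable M \<rho>"
    using obtain_positive_integrable_function by metis
  define J where "J u = (\<Sum>i\<in>I. \<integral>x. \<rho> x * exp (- u i x) \<partial>M)" for u
  define C where "C n = {u \<in> tuples. max_energy - 1 / real (Suc n) \<le> energy u}" for n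
  define j where "j n = Inf (J ` C n)" for n
  have exp_int: "integrable M (\<lambda>x. \<rho> x * exp (- u i x))" if "u \<in> tuples" "i \<in> I" for u i
  proof (rule Bochner_Integration.integrable_bound[OF \<rho>_int])
    have [measurable]: "u i \<in> borel_measurable M" using that by (rule tuples_measurable)
    show "(\<lambda>x. \<rho> x * exp (- u i x)) \<in> borel_measurable M" by measurable
    show "AE x in M. norm (\<rho> x * exp (- u i x)) \<le> norm (\<rho> x)"
      using \<rho>_pos tuples_nonneg[OF that] by (intro AE_I2) (auto simp: abs_mult intro!: mult_right_le_one_le)
  qed
  have J_nonneg: "0 \<le> J u" for u
    unfolding J_def using \<rho>_pos by (intro sum_nonneg integral_nonneg_AE AE_I2 mult_nonneg_nonneg) (auto simp: less_imp_le)
  have J_le: "J u \<le> (\<Sum>i\<in>I. \<integral>x. \<rho> x \<partial>M)" if "u \<in> tuples" for u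
    unfolding J_def using that \<rho>_pos tuples_nonneg
    by (intro sum_mono integral_mono exp_int \<rho>_int) (auto simp: mult_le_cancel_left1)
  have bdd: "bdd_below (J ` C n)" for n using J_nonneg by (auto intro!: bdd_belowI2)
  have C_ne: "C n \<noteq> {}" for n
  proof -
    have "max_energy - 1 / real (Suc n) < (SUP u\<in>tuples. energy u)"
      unfolding max_energy_def[symmetric] by simp
    moreover have "bdd_above (energy ` tuples)" using energy_le_max by (auto intro!: bdd_aboveI2)
    ultimately obtain u where "u \<in> tuples" "max_energy - 1 / real (Suc n) < energy u"
      using less_cSUP_iff[OF tuples_nonempty] by blast
    then show ?thesis unfolding C_def by force
  qed
  have C_mono: "C m \<subseteq> C n" if "n \<le> m" for n m
  proof -
    have "1 / real (Suc m) \<le> 1 / real (Suc n)" using that by (simp add: frac_le)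
    then show ?thesis unfolding C_def by force
  qed
  have C_mid: "mix (1/2) u v \<in> C n" if "u \<in> C n" "v \<in> C n" for u v n
    using that energy_midpoint[of u v] mix_in_tuples[of u v "1/2"] by (auto simp: C_def)
  have j_mono: "j n \<le> j m" if "n \<le> m" for n m
    unfolding j_def using C_ne C_mono[OF that] by (intro cInf_superset_mono bdd) auto
  have "\<exists>u. u \<in> C n \<and> J u < j n + 1 / real (Suc n)" for n
  proof -
    have "Inf (J ` C n) < j n + 1 / real (Suc n)" by (simp add: j_def)
    then show ?thesis using cInf_less_iff[OF _ bdd] C_ne by auto
  qed
  then obtain u where uC: "\<And>n. u n \<in> C n" and uJ: "\<And>n. J (u n) < j n + 1 / real (Suc n)"
    by metis
  have uT: "u n \<in> tuples" for n using uC by (auto simp: C_def)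
  have j_Cauchy: "Cauchy j"
  proof -
    have "j n \<le> (\<Sum>i\<in>I. \<integral>x. \<rho> x \<partial>M)" for n
      using cInf_lower[OF imageI[OF uC[of n]] bdd] J_le[OF uT[of n]] by (simp add: j_def)
    then have "bdd_above (range j)" by (auto intro!: bdd_aboveI2)
    moreover have "incseq j" using j_mono by (auto simp: incseq_def)
    ultimately show ?thesis
      by (rule LIMSEQ_imp_Cauchy[OF LIMSEQ_incseq_SUP])
  qed
  define d where "d i n m x = exp (- u n i x / 2) - exp (- u m i x / 2)" for i n m x
  define D where "D i n m = (\<integral>x. \<rho> x * (d i n m x)\<^sup>2 \<partial>M)" for i n m
  \<comment> \<open>The convexity defect \<open>a + b - 2 * sqrt (a * b)\<close> with \<open>a = exp (- u n i)\<close> and \<open>b = exp (- u m i)\<close>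
      is the square of \<open>sqrt a - sqrt b\<close>.\<close>
  have dsq: "(d i n m x)\<^sup>2 = exp (- u n i x) + exp (- u m i x) - 2 * exp (- mix (1/2) (u n) (u m) i x)"
    for i n m x
  proof -
    have "(exp (- u k i x / 2))\<^sup>2 = exp (- u k i x)" for k
      by (simp add: power2_eq_square exp_add[symmetric])
    moreover have "exp (- u n i x / 2) * exp (- u m i x / 2) = exp (- mix (1/2) (u n) (u m) i x)"
      by (simp add: mix_def flip: exp_add)
    ultimately show ?thesis by (simp add: d_def power2_diff mult.assoc)
  qed
  have dsq_int: "integrable M (\<lambda>x. \<rho> x * (d i n m x)\<^sup>2)" if "i \<in> I" for i n m
  proof -
    have "integrable M (\<lambda>x. \<rho> x * exp (- u n i x) + \<rho> x * exp (- u m i x)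
        - 2 * (\<rho> x * exp (- mix (1/2) (u n) (u m) i x)))"
      using that by (intro Bochner_Integration.integrable_diff Bochner_Integration.integrable_add
          integrable_mult_right exp_int uT mix_in_tuples) auto
    then show ?thesis by (simp add: dsq algebra_simps)
  qed
  have D_sum: "(\<Sum>i\<in>I. D i n m) = J (u n) + J (u m) - 2 * J (mix (1/2) (u n) (u m))" for n m
  proof -
    have "D i n m = (\<integral>x. \<rho> x * exp (- u n i x) \<partial>M) + (\<integral>x. \<rho> x * exp (- u m i x) \<partial>M)
        - 2 * (\<integral>x. \<rho> x * exp (- mix (1/2) (u n) (u m) i x) \<partial>M)" if "i \<in> I" for i
    proof -
      have "D i n m = (\<integral>x. \<rho> x * exp (- u n i x) + \<rho> x * exp (- u m i x)
        - 2 * (\<rho> x * exp (- mix (1/2) (u n) (u m) i x)) \<partial>M)"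
        unfolding D_def dsq by (simp add: algebra_simps)
      also have "\<dots> = (\<integral>x. \<rho> x * exp (- u n i x) \<partial>M) + (\<integral>x. \<rho> x * exp (- u m i x) \<partial>M)
        - 2 * (\<integral>x. \<rho> x * exp (- mix (1/2) (u n) (u m) i x) \<partial>M)"
        using exp_int[OF uT that] exp_int[OF mix_in_tuples[OF uT uT] that, of "1/2"] by simp
      finally show ?thesis .
    qed
    then show ?thesis by (simp add: J_def sum.distrib sum_subtractf sum_distrib_left)
  qed
  have D_nonneg: "0 \<le> D i n m" for i n m
    unfolding D_def using \<rho>_pos by (intro integral_nonneg_AE AE_I2) (auto simp: less_imp_le)
  have D_le: "D i n m \<le> j m - j n + 2 / real (Suc n)" if i: "i \<in> I" and nm: "n \<le> m" for i n m
  proof -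
    have "D i n m \<le> (\<Sum>i\<in>I. D i n m)"
      using i D_nonneg finite_I by (intro member_le_sum) auto
    also have "\<dots> \<le> (j n + 1 / real (Suc n)) + (j m + 1 / real (Suc m)) - 2 * j n"
    proof -
      have "mix (1/2) (u n) (u m) \<in> C n"
        using uC[of n] uC[of m] C_mono[OF nm] by (intro C_mid) auto
      then have "j n \<le> J (mix (1/2) (u n) (u m))"
        unfolding j_def by (intro cInf_lower bdd imageI)
      then show ?thesis using uJ[of n] uJ[of m] unfolding D_sum by linarith
    qed
    also have "\<dots> \<le> j m - j n + 2 / real (Suc n)"
    proof -
      have "1 / real (Suc m) \<le> 1 / real (Suc n)" using nm by (simp add: frac_le)
      moreover have "2 / real (Suc n) = 1 / real (Suc n) + 1 / real (Suc n)"
        by (simp add: add_divide_distrib[symmetric])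
      ultimately show ?thesis by linarith
    qed
    finally show ?thesis .
  qed
  have D_sym: "D i n m = D i m n" for i n m
    by (simp add: D_def d_def power2_commute)
  have D_Cauchy: "\<exists>N. \<forall>n\<ge>N. \<forall>m\<ge>N. D i n m < e" if i: "i \<in> I" and e: "0 < e" for i e
  proof -
    obtain N1 where N1: "\<And>n m. n \<ge> N1 \<Longrightarrow> m \<ge> N1 \<Longrightarrow> \<bar>j m - j n\<bar> < e / 2"
      using CauchyD[OF j_Cauchy, of "e/2"] e by auto
    obtain N2 where N2: "inverse (real (Suc N2)) < e / 4"
      using reals_Archimedean[of "e/4"] e by auto
    have "D i n m < e" if "n \<ge> max N1 N2" "m \<ge> n" for n m
    proof -
      have "1 / real (Suc n) \<le> 1 / real (Suc N2)" using that by (simp add: frac_le)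
      then have "2 / real (Suc n) < e / 2" using N2 by (simp add: inverse_eq_divide)
      moreover have "\<bar>j m - j n\<bar> < e / 2" using that by (intro N1) auto
      ultimately show ?thesis using D_le[OF i \<open>m \<ge> n\<close>] by linarith
    qed
    then have "\<forall>n\<ge>max N1 N2. \<forall>m\<ge>max N1 N2. D i n m < e"
      by (metis D_sym nle_le)
    then show ?thesis ..
  qed
  \<comment> \<open>From the weighted \<open>L\<^sup>2\<close> distance to \<open>L\<^sup>1\<close>, by \<open>\<bar>z\<bar> \<le> \<delta> + z\<^sup>2 / \<delta>\<close> and finiteness of \<open>\<integral> \<rho>\<close>.\<close>
  define s where "s i n x = \<rho> x * exp (- u n i x / 2)" for i n x
  have s_int: "integrable M (s i n)" if "i \<in> I" for i n
  proof (rule Bochner_Integration.integrable_bound[OF \<rho>_int])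
    have [measurable]: "u n i \<in> borel_measurable M" using uT that by (rule tuples_measurable)
    show "s i n \<in> borel_measurable M" unfolding s_def[abs_def] by measurable
    show "AE x in M. norm (s i n x) \<le> norm (\<rho> x)"
      using \<rho>_pos tuples_nonneg[OF uT that] by (intro AE_I2) (auto simp: abs_mult s_def intro!: mult_right_le_one_le)
  qed
  have s_Cauchy: "\<exists>N. \<forall>n\<ge>N. \<forall>m\<ge>N. (\<integral>x. \<bar>s i n x - s i m x\<bar> \<partial>M) < e"
    if i: "i \<in> I" and e: "0 < e" for i e
  proof -
    define R where "R = (\<integral>x. \<rho> x \<partial>M)"
    have R: "0 \<le> R" unfolding R_def using \<rho>_pos by (intro integral_nonneg_AE AE_I2) (auto simp: less_imp_le)
    define \<delta> where "\<delta> = e / (2 * (R + 1))"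
    have \<delta>: "0 < \<delta>" using e R by (simp add: \<delta>_def)
    obtain N where N: "\<And>n m. n \<ge> N \<Longrightarrow> m \<ge> N \<Longrightarrow> D i n m < \<delta> * (e / 2)"
      using D_Cauchy[OF i, of "\<delta> * (e/2)"] e \<delta> by auto
    have "(\<integral>x. \<bar>s i n x - s i m x\<bar> \<partial>M) < e" if "n \<ge> N" "m \<ge> N" for n m
    proof -
      have pt: "\<bar>s i n x - s i m x\<bar> \<le> \<delta> * \<rho> x + \<rho> x * (d i n m x)\<^sup>2 / \<delta>" for x
      proof -
        have "\<bar>z\<bar> \<le> \<delta> + z\<^sup>2 / \<delta>" for z :: real
        proof (cases "\<bar>z\<bar> \<le> \<delta>")
          case False
          then have "\<delta> * \<bar>z\<bar> \<le> \<bar>z\<bar> * \<bar>z\<bar>" by (intro mult_right_mono) auto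
          then have "\<bar>z\<bar> \<le> z\<^sup>2 / \<delta>" using \<delta> by (simp add: field_simps power2_eq_square)
          then show ?thesis using \<delta> by linarith
        qed (use \<delta> in \<open>simp add: add_increasing2\<close>)
        then have "\<rho> x * \<bar>d i n m x\<bar> \<le> \<rho> x * (\<delta> + (d i n m x)\<^sup>2 / \<delta>)"
          using \<rho>_pos[of x] by (intro mult_left_mono) auto
        moreover have "\<bar>s i n x - s i m x\<bar> = \<rho> x * \<bar>d i n m x\<bar>"
          using \<rho>_pos[of x] by (simp add: s_def d_def abs_mult flip: right_diff_distrib)
        ultimately show ?thesis by (simp add: algebra_simps)
      qed
      have "(\<integral>x. \<bar>s i n x - s i m x\<bar> \<partial>M) \<le> (\<integral>x. \<delta> * \<rho> x + \<rho> x * (d i n m x)\<^sup>2 / \<delta> \<partial>M)"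
        by (intro integral_mono integrable_abs Bochner_Integration.integrable_diff
            Bochner_Integration.integrable_add integrable_mult_right integrable_divide
            s_int \<rho>_int dsq_int i pt)
      also have "\<dots> = \<delta> * R + D i n m / \<delta>"
        using \<rho>_int dsq_int[OF i] by (simp add: R_def D_def)
      also have "\<dots> < \<delta> * R + e / 2"
        using N[OF that] \<delta> by (simp add: field_simps)
      also have "\<dots> \<le> e"
      proof -
        have "\<delta> * R \<le> \<delta> * (R + 1)" using \<delta> by simp
        also have "\<dots> = e / 2"
        proof -
          have "R + 1 \<noteq> 0" using R by simp
          then show ?thesis by (simp only: \<delta>_def times_divide_eq_left mult_divide_mult_cancel_right not_False_eq_True)
        qed
        finally show ?thesis by simp
      qed
      finally show ?thesis .
    qed
    then show ?thesis by blast
  qed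
  have "\<exists>r. strict_mono r \<and> (\<forall>i\<in>I. AE x in M. Cauchy (\<lambda>n. s i (r n) x))"
    by (rule finite_family_AE_Cauchy_subseq[OF finite_I]) (fact s_int, fact s_Cauchy)
  then obtain r where r: "strict_mono r" "\<And>i. i \<in> I \<Longrightarrow> AE x in M. Cauchy (\<lambda>n. s i (r n) x)"
    by blast
  define w where "w i x = lim (\<lambda>n. exp (- u (r n) i x / 2))" for i x
  show ?thesis
  proof (rule that[of "\<lambda>n. u (r n)" w])
    show "u (r n) \<in> tuples" for n by (rule uT)
    show "(\<lambda>n. energy (u (r n))) \<longlonglongrightarrow> max_energy"
    proof -
      have "(\<lambda>n. energy (u n)) \<longlonglongrightarrow> max_energy"
      proof (rule tendsto_sandwich)
        show "\<forall>\<^sub>F n in sequentially. max_energy - 1 / real (Suc n) \<le> energy (u n)"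
          using uC by (auto simp: C_def)
        show "\<forall>\<^sub>F n in sequentially. energy (u n) \<le> max_energy" using uT energy_le_max by auto
        have "(\<lambda>n. max_energy - inverse (real (Suc n))) \<longlonglongrightarrow> max_energy - 0"
          by (intro tendsto_intros LIMSEQ_inverse_real_of_nat)
        then show "(\<lambda>n. max_energy - 1 / real (Suc n)) \<longlonglongrightarrow> max_energy"
          by (simp add: inverse_eq_divide)
      qed simp
      from LIMSEQ_subseq_LIMSEQ[OF this r(1)] show ?thesis by (simp add: o_def)
    qed
    fix i assume i: "i \<in> I"
    have [measurable]: "u n i \<in> borel_measurable M" for n using uT i by (rule tuples_measurable)
    show "w i \<in> borel_measurable M" unfolding w_def[abs_def] by measurable
    show "AE x in M. (\<lambda>n. exp (- u (r n) i x / 2)) \<longlonglongrightarrow> w i x"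
      using r(2)[OF i]
    proof eventually_elim
      case (elim x)
      then have "convergent (\<lambda>n. s i (r n) x)" by (rule Cauchy_convergent)
      then obtain L where "(\<lambda>n. s i (r n) x) \<longlonglongrightarrow> L" by (auto simp: convergent_def)
      then have "(\<lambda>n. s i (r n) x / \<rho> x) \<longlonglongrightarrow> L / \<rho> x"
        using \<rho>_pos[of x] by (intro tendsto_divide tendsto_const) auto
      then have "convergent (\<lambda>n. s i (r n) x / \<rho> x)" by (auto simp: convergent_def)
      then show ?case
        using \<rho>_pos[of x] by (simp add: s_def w_def convergent_LIMSEQ_iff)
    qed
  qed
qed

lemma liminf_integrand_le_max:
  assumes v: "\<And>n. v n \<in> tuples"
  shows "(\<integral>\<^sup>+x. liminf (\<lambda>n. ennreal (integrand (v n) x)) \<partial>M) \<le> ennreal max_energy"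
proof -
  have "(\<integral>\<^sup>+x. liminf (\<lambda>n. ennreal (integrand (v n) x)) \<partial>M)
      \<le> liminf (\<lambda>n. \<integral>\<^sup>+x. ennreal (integrand (v n) x) \<partial>M)"
    by (intro nn_integral_liminf measurable_compose[OF _ measurable_ennreal] integrand_measurable
        tuples_measurable v)
  also have "\<dots> = liminf (\<lambda>n. ennreal (energy (v n)))" using nn_integral_integrand[OF v] by simp
  also have "\<dots> \<le> limsup (\<lambda>n. ennreal (energy (v n)))" by (rule Liminf_le_Limsup) simp
  also have "\<dots> \<le> ennreal max_energy"
    by (intro Limsup_bounded always_eventually allI ennreal_leI energy_le_max v)
  finally show ?thesis .
qed

text \<open>Limits of tuples compete for the maximum on equal terms. This replaces any discussion of a
  closure of the sets \<open>K i\<close>.\<close>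

lemma integrand_limit_le_max:
  assumes v: "\<And>n. v n \<in> tuples"
    and lim: "AE x in M. \<forall>i\<in>I. (\<lambda>n. v n i x) \<longlonglongrightarrow> V i x"
  shows "(\<integral>\<^sup>+x. ennreal (integrand V x) \<partial>M) \<le> ennreal max_energy"
proof -
  have "AE x in M. ennreal (integrand V x) \<le> liminf (\<lambda>n. ennreal (integrand (v n) x))"
    using lim
  proof eventually_elim
    case (elim x)
    have "(\<lambda>n. integrand (v n) x) \<longlonglongrightarrow> integrand V x"
      unfolding integrand_def
    proof (rule tendsto_powr'[OF tendsto_gmean tendsto_const])
      show "gmean (\<lambda>i. V i x) \<noteq> 0 \<or> 0 < q \<and> (\<forall>\<^sub>F n in sequentially. 0 \<le> gmean (\<lambda>i. v n i x))"
        using q_pos gmean_nonneg by simp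
    qed (use elim tuples_nonneg[OF v] in \<open>blast+\<close>)
    then have "(\<lambda>n. ennreal (integrand (v n) x)) \<longlonglongrightarrow> ennreal (integrand V x)" by (rule tendsto_ennrealI)
    then show ?case using lim_imp_Liminf[OF sequentially_bot] by fastforce
  qed
  then have "(\<integral>\<^sup>+x. ennreal (integrand V x) \<partial>M) \<le> (\<integral>\<^sup>+x. liminf (\<lambda>n. ennreal (integrand (v n) x)) \<partial>M)"
    by (rule nn_integral_mono_AE)
  also have "\<dots> \<le> ennreal max_energy" by (rule liminf_integrand_le_max[OF v])
  finally show ?thesis .
qed

text \<open>The zero set of \<open>w\<close> is where \<open>u n j\<close> tends to infinity. On a subset of it all components of some
  tuple \<open>h\<close> are positive, and there the integrands of the midpoints of \<open>u n\<close> and \<open>h\<close> tend to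
  infinity, because the components other than \<open>j\<close> stay above \<open>h i / 2\<close>. By Fatou's lemma this is
  incompatible with bounded energy.\<close>

lemma AE_limit_finite:
  assumes u: "\<And>n. u n \<in> tuples" and j: "j \<in> I"
    and w[measurable]: "w \<in> borel_measurable M"
    and lim: "AE x in M. (\<lambda>n. exp (- u n j x / 2)) \<longlonglongrightarrow> w x"
  shows "AE x in M. 0 < w x"
proof (rule AE_if_no_positive_counterset)
  fix E assume E: "E \<in> sets M" "0 < emeasure M E" "\<forall>x\<in>E. \<not> 0 < w x"
  obtain E' h where E': "E' \<in> sets M" "E' \<subseteq> E" "0 < emeasure M E'" and h: "h \<in> tuples"
    and hpos: "\<And>i x. i \<in> I \<Longrightarrow> x \<in> E' \<Longrightarrow> 0 < h i x"
    using saturating_tuple[OF E(1,2)] by blast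
  define v where "v n = mix (1/2) (u n) h" for n
  have v: "v n \<in> tuples" for n unfolding v_def by (intro mix_in_tuples u h) auto
  have v_meas: "(\<lambda>x. ennreal (integrand (v n) x)) \<in> borel_measurable M" for n
    by (intro measurable_compose[OF _ measurable_ennreal] integrand_measurable tuples_measurable v)
  have "(\<integral>\<^sup>+x. liminf (\<lambda>n. ennreal (integrand (v n) x)) \<partial>M) \<noteq> \<infinity>"
    using liminf_integrand_le_max[of v, OF v] by (auto simp: top_unique)
  then have fin: "AE x in M. liminf (\<lambda>n. ennreal (integrand (v n) x)) \<noteq> \<infinity>"
    by (intro nn_integral_PInf_AE borel_measurable_liminf v_meas)
  have "AE x in M. x \<notin> E'"
    using fin lim
  proof eventually_elim
    case (elim x)
    show ?case
    proof
      assume x: "x \<in> E'"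
      have "0 \<le> w x" by (rule tendsto_lowerbound[OF elim(2)]) auto
      then have "w x = 0" using E(3)[rule_format, of x] E'(2) x by (auto simp: not_less)
      then have "filterlim (\<lambda>n. exp (- u n j x / 2)) (at_right 0) sequentially"
        using elim(2) by (auto simp: filterlim_at)
      then have "filterlim (\<lambda>n. inverse (exp (- u n j x / 2))) at_top sequentially"
        by (rule filterlim_compose[OF filterlim_inverse_at_top_right])
      then have "filterlim (\<lambda>n. ln (exp (u n j x / 2))) at_top sequentially"
        by (intro filterlim_compose[OF ln_at_top]) (simp add: exp_minus[symmetric])
      then have half: "filterlim (\<lambda>n. u n j x / 2) at_top sequentially" by simp
      define b where "b i = h i x / 2" for i
      have b: "0 < b i" if "i \<in> I" for i using hpos[OF that x] by (simp add: b_def)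
      define c where "c n = inverse (b j) * (u n j x / 2)" for n
      have c0: "0 \<le> c n" for n using tuples_nonneg[OF u j] b[OF j] by (simp add: c_def)
      have clim: "filterlim c at_top sequentially"
        unfolding c_def by (rule filterlim_tendsto_pos_mult_at_top, rule tendsto_const) (use b[OF j] half in auto)
      have lower: "(c n powr \<alpha> j * gmean b) powr q \<le> integrand (v n) x" for n
      proof -
        have "c n powr \<alpha> j * gmean b = gmean (b(j := c n * b j))"
          using gmean_fun_upd[of j "c n" b] j c0 b[OF j] by simp
        also have "\<dots> \<le> gmean (\<lambda>i. v n i x)"
        proof (rule gmean_mono)
          fix i assume i: "i \<in> I"
          show "0 \<le> (b(j := c n * b j)) i" using c0 b i j by (auto simp: less_imp_le)
          show "(b(j := c n * b j)) i \<le> v n i x"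
            using hpos[OF i x] tuples_nonneg[OF u i] b[OF j] by (auto simp: v_def mix_def b_def c_def)
        qed
        finally show ?thesis unfolding integrand_def
          using q_pos gmean_nonneg[of b] by (intro powr_mono2) auto
      qed
      have "filterlim (\<lambda>n. (c n powr \<alpha> j * gmean b) powr q) at_top sequentially"
      proof -
        have 1: "filterlim (\<lambda>n. c n powr \<alpha> j) at_top sequentially"
          by (rule filterlim_compose[OF powr_at_top_at_top[OF weight_pos[OF j]] clim])
        have "filterlim (\<lambda>n. gmean b * c n powr \<alpha> j) at_top sequentially"
          by (rule filterlim_tendsto_pos_mult_at_top, rule tendsto_const) (use gmean_pos[OF b] 1 in auto)
        from filterlim_compose[OF powr_at_top_at_top[OF q_pos] this] show ?thesis
          by (simp add: mult.commute)
      qed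
      then have "filterlim (\<lambda>n. integrand (v n) x) at_top sequentially"
        by (rule filterlim_at_top_mono) (simp add: lower)
      then have "(\<lambda>n. ennreal (integrand (v n) x)) \<longlonglongrightarrow> \<infinity>"
        by (simp add: ennreal_tendsto_top_eq_at_top)
      then have "liminf (\<lambda>n. ennreal (integrand (v n) x)) = \<infinity>"
        using lim_imp_Liminf[OF sequentially_bot] by fastforce
      with elim(1) show False by simp
    qed
  qed
  then have "emeasure M E' = 0"
    using AE_iff_measurable[OF E'(1), of "\<lambda>x. x \<notin> E'"] sets.sets_into_space[OF E'(1)] by auto
  with E'(3) show False by simp
qed measurable

text \<open>The maximum is attained at a limit of tuples. The midpoint bound in \<open>powr_midpoint_no_mass_loss\<close>
  holds for \<open>b n = gmean (u n)\<close> because the geometric mean is concave.\<close>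

lemma exists_maximiser:
  obtains u U where "\<And>n. u n \<in> tuples"
    "\<And>i. i \<in> I \<Longrightarrow> U i \<in> borel_measurable M" "\<And>i x. 0 \<le> U i x"
    "AE x in M. \<forall>i\<in>I. (\<lambda>n. u n i x) \<longlonglongrightarrow> U i x"
    "(\<integral>\<^sup>+x. ennreal (integrand U x) \<partial>M) = ennreal max_energy"
proof -
  obtain u w where u: "\<And>n. u n \<in> tuples" and conv: "(\<lambda>n. energy (u n)) \<longlonglongrightarrow> max_energy"
    and w: "\<And>i. i \<in> I \<Longrightarrow> w i \<in> borel_measurable M"
    and lim: "\<And>i. i \<in> I \<Longrightarrow> AE x in M. (\<lambda>n. exp (- u n i x / 2)) \<longlonglongrightarrow> w i x"
    using exists_AE_convergent_maximising_sequence by blast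
  \<comment> \<open>The truncation at 0 matters only on a null set; it makes \<open>U\<close> nonnegative everywhere.\<close>
  define U where "U i x = max 0 (- 2 * ln (w i x))" for i x
  have U_meas: "U i \<in> borel_measurable M" if "i \<in> I" for i
  proof -
    note [measurable] = w[OF that]
    show ?thesis unfolding U_def[abs_def] by measurable
  qed
  have "AE x in M. (\<lambda>n. u n i x) \<longlonglongrightarrow> U i x" if i: "i \<in> I" for i
    using lim[OF i] AE_limit_finite[OF u i w[OF i] lim[OF i]]
  proof eventually_elim
    case (elim x)
    have "(\<lambda>n. max 0 (- 2 * ln (exp (- u n i x / 2)))) \<longlonglongrightarrow> U i x"
      unfolding U_def using elim by (intro tendsto_intros) auto
    then show ?case using tuples_nonneg[OF u i, of _ x] by (simp add: max_def)
  qed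
  then have U_lim: "AE x in M. \<forall>i\<in>I. (\<lambda>n. u n i x) \<longlonglongrightarrow> U i x"
    by (simp add: AE_finite_all[OF finite_I])
  have "ennreal max_energy \<le> (\<integral>\<^sup>+x. ennreal (integrand U x) \<partial>M)"
    unfolding integrand_def
  proof (rule powr_midpoint_no_mass_loss[where b = "\<lambda>n x. gmean (\<lambda>i. u n i x)"])
    have mid: "((gmean (\<lambda>i. u n i x) + gmean (\<lambda>i. u m i x)) / 2) powr q
        \<le> integrand (mix (1/2) (u n) (u m)) x" for n m x
      using integrand_mix[OF u u, of "1/2" n x m] by (simp add: add_divide_distrib)
    have mid_T: "mix (1/2) (u n) (u m) \<in> tuples" for n m by (intro mix_in_tuples u) auto
    have meas: "(\<lambda>x. gmean (\<lambda>i. u n i x)) \<in> borel_measurable M" for n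
      by (intro gmean_measurable tuples_measurable u)
    show mid_int: "integrable M (\<lambda>x. ((gmean (\<lambda>i. u n i x) + gmean (\<lambda>i. u m i x)) / 2) powr q)" for n m
    proof (rule Bochner_Integration.integrable_bound[OF integrable_integrand[OF mid_T[of n m]]])
      show "AE x in M. norm (((gmean (\<lambda>i. u n i x) + gmean (\<lambda>i. u m i x)) / 2) powr q)
          \<le> norm (integrand (mix (1/2) (u n) (u m)) x)"
        using mid[of n _ m] integrand_nonneg by (intro AE_I2) simp
    qed (intro powr_real_measurable borel_measurable_divide borel_measurable_add meas borel_measurable_const)
    show "(\<integral>x. ((gmean (\<lambda>i. u n i x) + gmean (\<lambda>i. u m i x)) / 2) powr q \<partial>M) \<le> max_energy" for n m
    proof -
      have "(\<integral>x. ((gmean (\<lambda>i. u n i x) + gmean (\<lambda>i. u m i x)) / 2) powr q \<partial>M)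
          \<le> energy (mix (1/2) (u n) (u m))"
        unfolding energy_def by (intro integral_mono mid_int integrable_integrand mid_T mid)
      also have "\<dots> \<le> max_energy" by (intro energy_le_max mid_T)
      finally show ?thesis .
    qed
    show "AE x in M. (\<lambda>n. gmean (\<lambda>i. u n i x)) \<longlonglongrightarrow> gmean (\<lambda>i. U i x)"
      using U_lim
    proof eventually_elim
      case (elim x)
      then show ?case using tuples_nonneg[OF u] by (intro tendsto_gmean) auto
    qed
    show "integrable M (\<lambda>x. gmean (\<lambda>i. u n i x) powr q)" for n
      using integrable_integrand[OF u, of n] by (simp add: integrand_def[abs_def])
    show "(\<lambda>n. \<integral>x. gmean (\<lambda>i. u n i x) powr q \<partial>M) \<longlonglongrightarrow> max_energy"
      using conv by (simp add: energy_def integrand_def)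
    show "(\<lambda>x. gmean (\<lambda>i. u n i x)) \<in> borel_measurable M" for n by (rule meas)
  qed (use q_pos q_less_1 gmean_nonneg gmean_measurable[OF U_meas] in auto)
  moreover have "(\<integral>\<^sup>+x. ennreal (integrand U x) \<partial>M) \<le> ennreal max_energy"
    by (rule integrand_limit_le_max[OF u U_lim])
  ultimately have "(\<integral>\<^sup>+x. ennreal (integrand U x) \<partial>M) = ennreal max_energy" by (rule antisym[rotated])
  moreover have "0 \<le> U i x" for i x by (simp add: U_def)
  ultimately show ?thesis by (intro that[OF u U_meas _ U_lim])
qed

section \<open>The Euler-Lagrange inequality and the dual weights\<close>

context
  fixes u :: "nat \<Rightarrow> 'i \<Rightarrow> 'a \<Rightarrow> real" and U :: "'i \<Rightarrow> 'a \<Rightarrow> real"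
  assumes u: "\<And>n. u n \<in> tuples"
    and U_meas: "\<And>i. i \<in> I \<Longrightarrow> U i \<in> borel_measurable M"
    and U_nonneg: "\<And>i x. 0 \<le> U i x"
    and U_lim: "AE x in M. \<forall>i\<in>I. (\<lambda>n. u n i x) \<longlonglongrightarrow> U i x"
    and U_max: "(\<integral>\<^sup>+x. ennreal (integrand U x) \<partial>M) = ennreal max_energy"
begin

lemma maximiser_integrand_measurable: "(\<lambda>x. ennreal (integrand U x)) \<in> borel_measurable M"
  by (intro measurable_compose[OF _ measurable_ennreal] integrand_measurable U_meas)

text \<open>If \<open>gmean U\<close> vanishes on \<open>E\<close>, mix in a proportion \<open>t\<close> of a tuple \<open>h\<close> that is positive on a part
  \<open>E'\<close> of \<open>E\<close>. Off \<open>E'\<close> the integrand drops at most by the factor \<open>(1 - t) powr q \<ge> 1 - t\<close>, and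
  on \<open>E'\<close> it rises from 0 to at least \<open>t powr q\<close> times that of \<open>h\<close>. Maximality gives
  \<open>t powr q * c \<le> t * max_energy\<close>, which is false for small \<open>t\<close>.\<close>

lemma maximiser_positive: "AE x in M. 0 < gmean (\<lambda>i. U i x)"
proof (rule AE_if_no_positive_counterset)
  have [measurable]: "(\<lambda>x. gmean (\<lambda>i. U i x)) \<in> borel_measurable M"
    by (rule gmean_measurable[OF U_meas])
  show "Measurable.pred M (\<lambda>x. 0 < gmean (\<lambda>i. U i x))" by measurable
next
  fix E assume E: "E \<in> sets M" "0 < emeasure M E" "\<forall>x\<in>E. \<not> 0 < gmean (\<lambda>i. U i x)"
  obtain E' h where E': "E' \<in> sets M" "E' \<subseteq> E" "0 < emeasure M E'" and h: "h \<in> tuples"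
    and hpos: "\<And>i x. i \<in> I \<Longrightarrow> x \<in> E' \<Longrightarrow> 0 < h i x"
    using saturating_tuple[OF E(1,2)] by blast
  define c where "c = (\<integral>x. integrand h x * indicator E' x \<partial>M)"
  have c: "0 < c" unfolding c_def by (rule energy_pos_if_pos_on[OF h E'(1,3) hpos])
  have c_nn: "(\<integral>\<^sup>+x. ennreal (integrand h x * indicator E' x) \<partial>M) = ennreal c"
    unfolding c_def using integrand_nonneg
    by (intro nn_integral_eq_integral integrable_real_mult_indicator E' integrable_integrand h) auto
  note [measurable] = maximiser_integrand_measurable
  have meas_h[measurable]: "(\<lambda>x. ennreal (integrand h x * indicator E' x)) \<in> borel_measurable M"
    by (intro measurable_compose[OF _ measurable_ennreal] borel_measurable_times
        borel_measurable_indicator E' integrand_measurable tuples_measurable h)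
  have bound: "t powr q * c \<le> t * max_energy" if t: "0 < t" "t < 1" for t
  proof -
    have pt: "(1 - t) powr q * integrand U x + t powr q * (integrand h x * indicator E' x)
        \<le> integrand (mix t U h) x" for x
    proof -
      have conc: "(1 - t) * gmean (\<lambda>i. U i x) + t * gmean (\<lambda>i. h i x) \<le> gmean (\<lambda>i. mix t U h i x)"
        unfolding mix_def using t U_nonneg tuples_nonneg[OF h] by (intro gmean_concave) auto
      show ?thesis
      proof (cases "x \<in> E'")
        case True
        then have "gmean (\<lambda>i. U i x) = 0" using E(3) E'(2) gmean_nonneg by (meson linorder_less_linear not_le subsetD)
        then have "(t * gmean (\<lambda>i. h i x)) powr q \<le> integrand (mix t U h) x"
          unfolding integrand_def using conc t q_pos gmean_nonneg[of "\<lambda>i. h i x"] by (intro powr_mono2) auto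
        then show ?thesis using True \<open>gmean (\<lambda>i. U i x) = 0\<close> t gmean_nonneg[of "\<lambda>i. h i x"]
          by (simp add: integrand_def powr_mult)
      next
        case False
        have "0 \<le> t * gmean (\<lambda>i. h i x)" using t gmean_nonneg by simp
        then have "((1 - t) * gmean (\<lambda>i. U i x)) powr q \<le> integrand (mix t U h) x"
          unfolding integrand_def using conc t q_pos gmean_nonneg[of "\<lambda>i. U i x"] by (intro powr_mono2) auto
        then show ?thesis using False t gmean_nonneg[of "\<lambda>i. U i x"]
          by (simp add: integrand_def powr_mult)
      qed
    qed
    have "ennreal ((1 - t) powr q * max_energy + t powr q * c)
        = ennreal ((1 - t) powr q) * (\<integral>\<^sup>+x. ennreal (integrand U x) \<partial>M)
          + ennreal (t powr q) * (\<integral>\<^sup>+x. ennreal (integrand h x * indicator E' x) \<partial>M)"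
      using c max_energy_pos by (simp add: U_max c_nn ennreal_mult)
    also have "\<dots> = (\<integral>\<^sup>+x. ennreal ((1 - t) powr q) * ennreal (integrand U x)
          + ennreal (t powr q) * ennreal (integrand h x * indicator E' x) \<partial>M)"
      by (simp add: nn_integral_add nn_integral_cmult)
    also have "\<dots> \<le> (\<integral>\<^sup>+x. ennreal (integrand (mix t U h) x) \<partial>M)"
      using pt integrand_nonneg
      by (intro nn_integral_mono) (simp add: ennreal_mult[symmetric] ennreal_plus[symmetric] ennreal_leI del: ennreal_plus)
    also have "\<dots> \<le> ennreal max_energy"
    proof (rule integrand_limit_le_max)
      show "mix t (u n) h \<in> tuples" for n using t by (intro mix_in_tuples u h) auto
      show "AE x in M. \<forall>i\<in>I. (\<lambda>n. mix t (u n) h i x) \<longlonglongrightarrow> mix t U h i x"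
        using U_lim by eventually_elim (auto simp: mix_def intro!: tendsto_intros)
    qed
    finally have "(1 - t) powr q * max_energy + t powr q * c \<le> max_energy"
      using max_energy_pos by (simp add: ennreal_le_iff)
    moreover have "(1 - t) * max_energy \<le> (1 - t) powr q * max_energy"
      using powr_mono'[of q 1 "1 - t"] t q_less_1 max_energy_pos by (intro mult_right_mono) auto
    ultimately show ?thesis by (simp add: algebra_simps)
  qed
  \<comment> \<open>Choose \<open>t\<close> with \<open>t powr (1 - q) * max_energy \<le> c / 2\<close>.\<close>
  define a where "a = c / (2 * max_energy)"
  have a: "0 < a" using c max_energy_pos by (simp add: a_def)
  define t where "t = min (1/2) (a powr (1 / (1 - q)))"
  have t: "0 < t" "t < 1" using a by (auto simp: t_def)
  have "t powr (1 - q) \<le> (a powr (1 / (1 - q))) powr (1 - q)"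
    using q_less_1 t by (intro powr_mono2) (auto simp: t_def)
  also have "\<dots> = a" using q_less_1 a by (simp add: powr_powr)
  finally have "t powr (1 - q) * max_energy \<le> a * max_energy"
    using max_energy_pos by (intro mult_right_mono) auto
  also have "\<dots> = c / 2" using max_energy_pos by (simp add: a_def)
  finally have small: "t powr (1 - q) * max_energy \<le> c / 2" .
  have "t = t powr q * t powr (1 - q)" using t by (simp flip: powr_add)
  then have "t powr q * c \<le> t powr q * (t powr (1 - q) * max_energy)"
    using bound[OF t] by (metis mult.assoc)
  then have "c \<le> t powr (1 - q) * max_energy" using t by simp
  with small c show False by simp
qed

text \<open>Replacing \<open>U j\<close> by \<open>(1 - t) * U j + t * v\<close> multiplies the integrand by
  \<open>((1 - t) + t * r) powr s\<close> with \<open>r = v / U j\<close> and \<open>s = q * \<alpha> j\<close>. Subtracting the contribution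
  \<open>(1 - t) powr s\<close> of \<open>r = 0\<close> leaves a nonnegative difference quotient \<open>h t\<close> that tends to
  \<open>s * r\<close> times the integrand as \<open>t\<close> tends to 0, so Fatou's lemma applies and yields the
  integrability of the limit. The bound on its integral is the quotient for \<open>r = 1\<close>, which tends
  to \<open>s * max_energy\<close>.\<close>

lemma first_variation:
  assumes j: "j \<in> I" and v: "v \<in> K j"
  shows "(\<integral>\<^sup>+x. ennreal (integrand U x * (v x / U j x)) \<partial>M) \<le> ennreal max_energy"
proof -
  define s where "s = q * \<alpha> j"
  have s: "0 < s" using q_pos weight_pos[OF j] by (simp add: s_def)
  define r where "r x = v x / U j x" for x
  have v0: "0 \<le> v x" for x using K_nonneg[OF j v] .
  have r0: "0 \<le> r x" for x using v0 U_nonneg by (simp add: r_def)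
  note [measurable] = K_measurable[OF j v] U_meas[OF j] integrand_measurable[OF U_meas]
  have r_meas[measurable]: "r \<in> borel_measurable M" unfolding r_def[abs_def] by measurable
  define h where "h t x = integrand U x * ((((1 - t) + t * r x) powr s - (1 - t) powr s) / t)" for t x
  have h0: "0 \<le> h t x" if "0 < t" "t < 1" for t x
    unfolding h_def using that r0 s integrand_nonneg
    by (intro mult_nonneg_nonneg divide_nonneg_pos) (auto intro!: powr_mono2)
  have h_meas[measurable]: "h t \<in> borel_measurable M" for t unfolding h_def[abs_def] by measurable
  have h_le: "(\<integral>\<^sup>+x. ennreal (h t x) \<partial>M) \<le> ennreal (max_energy * ((1 - (1 - t) powr s) / t))"
    if t: "0 < t" "t < 1" for t
  proof -
    define V where "V = U(j := \<lambda>x. (1 - t) * U j x + t * v x)"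
    have "AE x in M. ennreal t * ennreal (h t x) + ennreal ((1 - t) powr s) * ennreal (integrand U x)
        = ennreal (integrand V x)"
      using maximiser_positive
    proof eventually_elim
      case (elim x)
      have "U j x \<noteq> 0" using elim gmean_eq_0[OF j, of "\<lambda>i. U i x"] by auto
      define c where "c = (1 - t) + t * r x"
      have c: "0 \<le> c" using t r0 by (simp add: c_def)
      have "(\<lambda>i. V i x) = (\<lambda>i. U i x)(j := c * U j x)"
        using \<open>U j x \<noteq> 0\<close> by (auto simp: V_def c_def r_def fun_eq_iff algebra_simps)
      then have "integrand V x = (c powr \<alpha> j * gmean (\<lambda>i. U i x)) powr q"
        using gmean_fun_upd[OF j c, of "\<lambda>i. U i x"] U_nonneg by (simp add: integrand_def)
      also have "\<dots> = c powr s * integrand U x"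
        using gmean_nonneg by (simp add: integrand_def powr_mult powr_powr s_def mult.commute)
      also have "\<dots> = t * h t x + (1 - t) powr s * integrand U x"
      proof -
        have "t * h t x = integrand U x * (c powr s - (1 - t) powr s)"
          using t by (simp add: h_def c_def)
        then show ?thesis by (simp add: algebra_simps)
      qed
      finally show ?case
        using t h0[OF t] integrand_nonneg by (simp add: ennreal_mult[symmetric] ennreal_plus[symmetric] del: ennreal_plus)
    qed
    then have "(\<integral>\<^sup>+x. ennreal t * ennreal (h t x) + ennreal ((1 - t) powr s) * ennreal (integrand U x) \<partial>M)
        = (\<integral>\<^sup>+x. ennreal (integrand V x) \<partial>M)"
      by (rule nn_integral_cong_AE)
    also have "\<dots> \<le> ennreal max_energy"
    proof (rule integrand_limit_le_max)
      show "(u n)(j := \<lambda>x. (1 - t) * u n j x + t * v x) \<in> tuples" for n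
        using u[of n] K_convex[OF j _ v, of "u n j" t] j t by (auto simp: tuples_def)
      show "AE x in M. \<forall>i\<in>I. (\<lambda>n. ((u n)(j := \<lambda>x. (1 - t) * u n j x + t * v x)) i x) \<longlonglongrightarrow> V i x"
        using U_lim by eventually_elim (use j in \<open>auto simp: V_def intro!: tendsto_intros\<close>)
    qed
    also have "(\<integral>\<^sup>+x. ennreal t * ennreal (h t x) + ennreal ((1 - t) powr s) * ennreal (integrand U x) \<partial>M)
        = ennreal t * (\<integral>\<^sup>+x. ennreal (h t x) \<partial>M) + ennreal ((1 - t) powr s * max_energy)"
      using max_energy_pos by (simp add: nn_integral_add nn_integral_cmult U_max ennreal_mult)
    finally have le: "ennreal t * (\<integral>\<^sup>+x. ennreal (h t x) \<partial>M) + ennreal ((1 - t) powr s * max_energy)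
        \<le> ennreal max_energy" .
    show ?thesis
    proof (cases "\<integral>\<^sup>+x. ennreal (h t x) \<partial>M")
      case (real X)
      then have "ennreal (t * X + (1 - t) powr s * max_energy) \<le> ennreal max_energy"
        using le t max_energy_pos by (simp add: ennreal_mult)
      then have "t * X \<le> max_energy * (1 - (1 - t) powr s)"
        using max_energy_pos by (simp add: ennreal_le_iff algebra_simps)
      then have "X \<le> max_energy * ((1 - (1 - t) powr s) / t)"
        using t by (simp add: field_simps)
      then show ?thesis using real by (simp add: ennreal_leI)
    next
      case top
      then have False using le t by (auto simp: ennreal_mult_top top_unique)
      then show ?thesis ..
    qed
  qed
  define \<tau> where "\<tau> n = 1 / real (n + 2)" for n
  have \<tau>: "0 < \<tau> n" "\<tau> n < 1" for n by (auto simp: \<tau>_def)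
  have \<tau>_lim: "filterlim \<tau> (at 0) sequentially"
  proof -
    have "(\<lambda>n. inverse (real (Suc (Suc n)))) \<longlonglongrightarrow> 0"
      by (rule LIMSEQ_Suc[OF LIMSEQ_inverse_real_of_nat])
    moreover have "\<tau> = (\<lambda>n. inverse (real (Suc (Suc n))))"
      by (auto simp: \<tau>_def fun_eq_iff inverse_eq_divide)
    ultimately show ?thesis using \<tau>(1) by (auto simp: filterlim_at less_imp_neq[symmetric])
  qed
  have quot: "(\<lambda>n. (((1 - \<tau> n) + \<tau> n * a) powr s - (1 - \<tau> n) powr s) / \<tau> n) \<longlonglongrightarrow> s * a" for a
  proof -
    have "((\<lambda>t. ((1 - t) + t * a) powr s - (1 - t) powr s) has_real_derivative s * a) (at 0)"
      by (auto intro!: derivative_eq_intros simp: algebra_simps)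
    then have "(\<lambda>t. (((1 - t) + t * a) powr s - (1 - t) powr s) / t) \<midarrow>0\<rightarrow> s * a"
      by (simp add: DERIV_def)
    from filterlim_compose[OF this \<tau>_lim] show ?thesis .
  qed
  have "(\<integral>\<^sup>+x. ennreal (s * (integrand U x * r x)) \<partial>M) = (\<integral>\<^sup>+x. liminf (\<lambda>n. ennreal (h (\<tau> n) x)) \<partial>M)"
  proof (rule nn_integral_cong)
    fix x
    have "(\<lambda>n. h (\<tau> n) x) \<longlonglongrightarrow> integrand U x * (s * r x)"
      unfolding h_def by (intro tendsto_mult tendsto_const quot)
    then have "(\<lambda>n. ennreal (h (\<tau> n) x)) \<longlonglongrightarrow> ennreal (s * (integrand U x * r x))"
      by (intro tendsto_ennrealI) (simp add: mult_ac)
    then show "ennreal (s * (integrand U x * r x)) = liminf (\<lambda>n. ennreal (h (\<tau> n) x))"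
      using lim_imp_Liminf[OF sequentially_bot] by fastforce
  qed
  also have "\<dots> \<le> liminf (\<lambda>n. \<integral>\<^sup>+x. ennreal (h (\<tau> n) x) \<partial>M)"
    by (intro nn_integral_liminf) measurable
  also have "\<dots> \<le> liminf (\<lambda>n. ennreal (max_energy * ((1 - (1 - \<tau> n) powr s) / \<tau> n)))"
    by (intro Liminf_mono always_eventually allI h_le \<tau>)
  also have "\<dots> = ennreal (max_energy * s)"
  proof (rule lim_imp_Liminf)
    have "(\<lambda>n. max_energy * ((1 - (1 - \<tau> n) powr s) / \<tau> n)) \<longlonglongrightarrow> max_energy * (s * 1)"
      by (intro tendsto_mult tendsto_const) (use quot[of 1] in simp)
    then show "(\<lambda>n. ennreal (max_energy * ((1 - (1 - \<tau> n) powr s) / \<tau> n))) \<longlonglongrightarrow> ennreal (max_energy * s)"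
      by (intro tendsto_ennrealI) simp
  qed simp
  finally have main: "(\<integral>\<^sup>+x. ennreal (s * (integrand U x * r x)) \<partial>M) \<le> ennreal (max_energy * s)" .
  have "(\<integral>\<^sup>+x. ennreal (integrand U x * (v x / U j x)) \<partial>M)
      = (\<integral>\<^sup>+x. ennreal (1 / s) * ennreal (s * (integrand U x * r x)) \<partial>M)"
  proof (rule nn_integral_cong)
    fix x
    have "integrand U x * (v x / U j x) = 1 / s * (s * (integrand U x * r x))"
      using s by (simp add: r_def)
    then show "ennreal (integrand U x * (v x / U j x)) = ennreal (1 / s) * ennreal (s * (integrand U x * r x))"
      using s r0[of x] integrand_nonneg[of U x] by (simp only: ennreal_mult[symmetric] mult_nonneg_nonneg less_imp_le zero_le_divide_1_iff)
  qed
  also have "\<dots> = ennreal (1 / s) * (\<integral>\<^sup>+x. ennreal (s * (integrand U x * r x)) \<partial>M)"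
    by (intro nn_integral_cmult) measurable
  also have "\<dots> \<le> ennreal (1 / s) * ennreal (max_energy * s)"
    by (intro mult_left_mono main) auto
  also have "\<dots> = ennreal max_energy"
    using s max_energy_pos by (simp add: ennreal_mult[symmetric])
  finally show ?thesis .
qed

end

text \<open>The weights \<open>g i\<close> are the multipliers of the Euler-Lagrange inequality, normalised by the power
  of the maximal energy that makes the integral equal to 1. The value 1 on the null set where
  \<open>gmean U\<close> vanishes keeps \<open>g i\<close> positive everywhere.\<close>

theorem exists_dual_weights:
  obtains g where "\<And>i. i \<in> I \<Longrightarrow> g i \<in> borel_measurable M" "\<And>i x. i \<in> I \<Longrightarrow> 0 < g i x"
    "(\<integral>\<^sup>+x. ennreal (gmean (\<lambda>i. g i x) powr (q / (q - 1))) \<partial>M) = 1"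
    "\<And>i v. i \<in> I \<Longrightarrow> v \<in> K i \<Longrightarrow>
        (\<integral>\<^sup>+x. ennreal (g i x * v x) \<partial>M) \<le> ennreal (max_energy powr (1 / q))"
proof -
  obtain u U where u: "\<And>n. u n \<in> tuples"
    and U_meas: "\<And>i. i \<in> I \<Longrightarrow> U i \<in> borel_measurable M" and U_nonneg: "\<And>i x. 0 \<le> U i x"
    and U_lim: "AE x in M. \<forall>i\<in>I. (\<lambda>n. u n i x) \<longlonglongrightarrow> U i x"
    and U_max: "(\<integral>\<^sup>+x. ennreal (integrand U x) \<partial>M) = ennreal max_energy"
    using exists_maximiser by blast
  have mp: "AE x in M. 0 < gmean (\<lambda>i. U i x)"
    by (rule maximiser_positive[OF u U_meas U_nonneg U_lim U_max])
  have fv: "(\<integral>\<^sup>+x. ennreal (integrand U x * (v x / U i x)) \<partial>M) \<le> ennreal max_energy"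
    if "i \<in> I" "v \<in> K i" for i v
    by (rule first_variation[OF u U_meas U_nonneg U_lim U_max that])
  define k where "k = max_energy powr (1 / q - 1)"
  have k: "0 < k" using max_energy_pos by (simp add: k_def)
  define g where "g i x = (if 0 < gmean (\<lambda>i. U i x) then k * integrand U x / U i x else 1)" for i x
  have U_pos: "0 < U i x" if "0 < gmean (\<lambda>i. U i x)" "i \<in> I" for i x
    using that gmean_eq_0[of i "\<lambda>i. U i x"] U_nonneg[of i x] by (cases "U i x = 0") auto
  note [measurable] = gmean_measurable[OF U_meas] integrand_measurable[OF U_meas]
  show ?thesis
  proof (rule that)
    show "g i \<in> borel_measurable M" if "i \<in> I" for i
    proof -
      note [measurable] = U_meas[OF that]
      show ?thesis unfolding g_def[abs_def] by measurable
    qed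
    show "0 < g i x" if "i \<in> I" for i x
      using U_pos[OF _ that] k by (auto simp: g_def integrand_def)
    have "AE x in M. ennreal (gmean (\<lambda>i. g i x) powr (q / (q - 1)))
        = ennreal (1 / max_energy) * ennreal (integrand U x)"
      using mp
    proof eventually_elim
      case (elim x)
      let ?G = "gmean (\<lambda>i. U i x)"
      have "gmean (\<lambda>i. g i x) = gmean (\<lambda>i. (k * integrand U x) * 1 / U i x)"
        using elim by (intro gmean_cong) (simp add: g_def)
      also have "\<dots> = gmean (\<lambda>i. (k * integrand U x) * 1) / ?G"
        using U_pos[OF elim] k integrand_nonneg by (intro gmean_divide) auto
      also have "gmean (\<lambda>i. (k * integrand U x) * 1) = k * integrand U x"
        using k integrand_nonneg by (subst gmean_scale) (auto simp: geometric_mean_def)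
      finally have "gmean (\<lambda>i. g i x) = k * (?G powr q / ?G)" by (simp add: integrand_def)
      also have "?G powr q / ?G = ?G powr (q - 1)"
        using elim by (simp add: powr_diff)
      finally have "gmean (\<lambda>i. g i x) powr (q / (q - 1))
          = k powr (q / (q - 1)) * (?G powr (q - 1)) powr (q / (q - 1))"
        using k by (simp add: powr_mult)
      also have "(?G powr (q - 1)) powr (q / (q - 1)) = integrand U x"
        using q_less_1 by (simp add: powr_powr integrand_def)
      also have "k powr (q / (q - 1)) = max_energy powr (- 1)"
      proof -
        have "(1 / q - 1) * (q / (q - 1)) = - 1" using q_pos q_less_1 by (simp add: field_simps)
        then show ?thesis unfolding k_def powr_powr by (rule arg_cong)
      qed
      also have "\<dots> = 1 / max_energy" using max_energy_pos by (simp add: powr_minus_divide)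
      finally show ?case
        using max_energy_pos integrand_nonneg by (simp add: ennreal_mult[symmetric])
    qed
    then have "(\<integral>\<^sup>+x. ennreal (gmean (\<lambda>i. g i x) powr (q / (q - 1))) \<partial>M)
        = (\<integral>\<^sup>+x. ennreal (1 / max_energy) * ennreal (integrand U x) \<partial>M)"
      by (rule nn_integral_cong_AE)
    also have "\<dots> = ennreal (1 / max_energy) * ennreal max_energy"
      by (subst nn_integral_cmult) (auto simp: U_max)
    also have "\<dots> = 1" using max_energy_pos by (simp add: ennreal_mult[symmetric])
    finally show "(\<integral>\<^sup>+x. ennreal (gmean (\<lambda>i. g i x) powr (q / (q - 1))) \<partial>M) = 1" .
    fix i v assume i: "i \<in> I" and v: "v \<in> K i"
    note [measurable] = U_meas[OF i] K_measurable[OF i v]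
    have "AE x in M. ennreal (g i x * v x) = ennreal k * ennreal (integrand U x * (v x / U i x))"
      using mp
    proof eventually_elim
      case (elim x)
      then show ?case using U_pos[OF elim i] k K_nonneg[OF i v, of x] integrand_nonneg
        by (simp add: g_def ennreal_mult[symmetric])
    qed
    then have "(\<integral>\<^sup>+x. ennreal (g i x * v x) \<partial>M)
        = (\<integral>\<^sup>+x. ennreal k * ennreal (integrand U x * (v x / U i x)) \<partial>M)"
      by (rule nn_integral_cong_AE)
    also have "\<dots> = ennreal k * (\<integral>\<^sup>+x. ennreal (integrand U x * (v x / U i x)) \<partial>M)"
      by (intro nn_integral_cmult) measurable
    also have "\<dots> \<le> ennreal k * ennreal max_energy"
      by (intro mult_left_mono fv i v) auto
    also have "\<dots> = ennreal (max_energy powr (1 / q))"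
    proof -
      have "k * max_energy = max_energy powr (1 / q - 1) * max_energy powr 1"
        using max_energy_pos by (simp add: k_def)
      also have "\<dots> = max_energy powr (1 / q)" unfolding powr_add[symmetric] by simp
      finally show ?thesis using k max_energy_pos by (simp add: ennreal_mult[symmetric])
    qed
    finally show "(\<integral>\<^sup>+x. ennreal (g i x * v x) \<partial>M) \<le> ennreal (max_energy powr (1 / q))" .
  qed
qed

end

section \<open>Norms of simple functions\<close>

lemma epowr_ennreal:
  assumes "0 \<le> x" "0 < a"
  shows "epowr (ennreal x) a = ennreal (x powr a)"
  using assms by (auto simp: epowr_def)

text \<open>The next facts turn bounds on the extended norms into bounds on integrals of real powers.\<close>

lemma epowr_inverse_le_iff:
  assumes "0 < a" "0 \<le> c"
  shows "epowr X (1 / a) \<le> ennreal c \<longleftrightarrow> X \<le> ennreal (c powr a)"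
proof (cases X)
  case (real x)
  have "x powr (1 / a) \<le> c \<longleftrightarrow> x \<le> c powr a"
  proof
    assume "x powr (1 / a) \<le> c"
    then have "(x powr (1 / a)) powr a \<le> c powr a" using assms by (intro powr_mono2) auto
    then show "x \<le> c powr a" using real assms by (simp add: powr_powr)
  next
    assume "x \<le> c powr a"
    then have "x powr (1 / a) \<le> (c powr a) powr (1 / a)" using assms real by (intro powr_mono2) auto
    then show "x powr (1 / a) \<le> c" using assms by (simp add: powr_powr)
  qed
  then show ?thesis using real assms by (simp add: epowr_ennreal ennreal_le_iff)
next
  case top
  then show ?thesis using assms by (simp add: epowr_def top_unique)
qed

lemma epowr_le_1:
  assumes "x \<le> 1" "0 < a"
  shows "epowr x a \<le> 1"
  using epowr_inverse_le_iff[of "1 / a" 1 x] assms by simp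

lemma Lnorm_le_iff:
  assumes "0 < r" "0 \<le> c"
  shows "Lnorm N (ereal r) f \<le> ennreal c
    \<longleftrightarrow> (\<integral>\<^sup>+y. ennreal (\<bar>f y\<bar> powr r) \<partial>N) \<le> ennreal (c powr r)"
  using assms by (simp add: Lnorm_def epowr_ennreal epowr_inverse_le_iff)

lemma Lnorm_infinity_le_iff:
  assumes [measurable]: "f \<in> borel_measurable N" and c: "0 \<le> c"
  shows "Lnorm N \<infinity> f \<le> ennreal c \<longleftrightarrow> (AE y in N. \<bar>f y\<bar> \<le> c)"
proof
  assume le: "Lnorm N \<infinity> f \<le> ennreal c"
  have "AE y in N. ennreal \<bar>f y\<bar> \<le> esssup N (\<lambda>y. ennreal \<bar>f y\<bar>)" by (rule esssup_AE)
  then show "AE y in N. \<bar>f y\<bar> \<le> c"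
  proof eventually_elim
    case (elim y)
    then have "ennreal \<bar>f y\<bar> \<le> ennreal c" using le by (simp add: Lnorm_def)
    then show ?case using c by (simp add: ennreal_le_iff)
  qed
next
  assume "AE y in N. \<bar>f y\<bar> \<le> c"
  then show "Lnorm N \<infinity> f \<le> ennreal c"
    unfolding Lnorm_def using c by (auto intro!: esssup_I ennreal_leI elim: eventually_mono)
qed

text \<open>For finite exponents this follows from convexity of the power alone: on the unit ball the norm
  and its \<open>r\<close>-th power satisfy the same bound 1, so Minkowski's inequality is bypassed.\<close>

lemma Lnorm_ball_convex:
  assumes [measurable]: "f \<in> borel_measurable N" "g \<in> borel_measurable N"
    and p: "1 \<le> p" and t: "0 \<le> t" "t \<le> 1"
    and f: "Lnorm N p f \<le> 1" and g: "Lnorm N p g \<le> 1"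
  shows "Lnorm N p (\<lambda>y. (1 - t) * f y + t * g y) \<le> 1"
proof -
  have tri: "\<bar>(1 - t) * a + t * b\<bar> \<le> (1 - t) * \<bar>a\<bar> + t * \<bar>b\<bar>" for a b :: real
    using t abs_triangle_ineq[of "(1 - t) * a" "t * b"] by (simp add: abs_mult)
  show ?thesis
  proof (cases p)
    case (real r)
    then have r: "1 \<le> r" using p by simp
    have "(\<integral>\<^sup>+y. ennreal (\<bar>(1 - t) * f y + t * g y\<bar> powr r) \<partial>N)
        \<le> (\<integral>\<^sup>+y. ennreal (1 - t) * ennreal (\<bar>f y\<bar> powr r) + ennreal t * ennreal (\<bar>g y\<bar> powr r) \<partial>N)"
    proof (rule nn_integral_mono)
      fix y
      have "\<bar>(1 - t) * f y + t * g y\<bar> powr r \<le> ((1 - t) * \<bar>f y\<bar> + t * \<bar>g y\<bar>) powr r"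
        using r by (intro powr_mono2 tri) auto
      also have "\<dots> \<le> (1 - t) * \<bar>f y\<bar> powr r + t * \<bar>g y\<bar> powr r"
        using r t by (intro powr_convex_combination) auto
      finally show "ennreal (\<bar>(1 - t) * f y + t * g y\<bar> powr r)
          \<le> ennreal (1 - t) * ennreal (\<bar>f y\<bar> powr r) + ennreal t * ennreal (\<bar>g y\<bar> powr r)"
        using t by (simp add: ennreal_mult[symmetric] ennreal_plus[symmetric] ennreal_leI del: ennreal_plus)
    qed
    also have "\<dots> = ennreal (1 - t) * (\<integral>\<^sup>+y. ennreal (\<bar>f y\<bar> powr r) \<partial>N)
        + ennreal t * (\<integral>\<^sup>+y. ennreal (\<bar>g y\<bar> powr r) \<partial>N)"
      by (simp add: nn_integral_add nn_integral_cmult)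
    also have "\<dots> \<le> ennreal (1 - t) * 1 + ennreal t * 1"
      using f g Lnorm_le_iff[of r 1 N] r real by (intro add_mono mult_left_mono) auto
    also have "\<dots> = 1" using t by (simp add: ennreal_plus[symmetric] del: ennreal_plus)
    finally show ?thesis using Lnorm_le_iff[of r 1 N] r real by simp
  next
    case PInf
    have "AE y in N. \<bar>f y\<bar> \<le> 1" "AE y in N. \<bar>g y\<bar> \<le> 1"
      using Lnorm_infinity_le_iff[of f N 1] Lnorm_infinity_le_iff[of g N 1] f g PInf by auto
    then have "AE y in N. \<bar>(1 - t) * f y + t * g y\<bar> \<le> 1"
    proof eventually_elim
      case (elim y)
      have "(1 - t) * \<bar>f y\<bar> + t * \<bar>g y\<bar> \<le> (1 - t) * 1 + t * 1"
        using elim t by (intro add_mono mult_left_mono) auto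
      then show ?case using tri[of "f y" "g y"] by simp
    qed
    then show ?thesis using Lnorm_infinity_le_iff[of "\<lambda>y. (1 - t) * f y + t * g y" N 1] PInf by simp
  qed (use p in auto)
qed

lemma Lnorm_scale_le_1:
  assumes [measurable]: "f \<in> borel_measurable N" and p: "1 \<le> p" and c: "0 < c"
    and f: "Lnorm N p f \<le> ennreal c"
  shows "Lnorm N p (\<lambda>y. 1 / c * f y) \<le> 1"
proof (cases p)
  case (real r)
  then have r: "1 \<le> r" using p by simp
  have "(\<integral>\<^sup>+y. ennreal (\<bar>1 / c * f y\<bar> powr r) \<partial>N)
      = (\<integral>\<^sup>+y. ennreal (1 / c powr r) * ennreal (\<bar>f y\<bar> powr r) \<partial>N)"
    using c by (intro nn_integral_cong) (simp add: ennreal_mult[symmetric] abs_mult powr_divide)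
  also have "\<dots> = ennreal (1 / c powr r) * (\<integral>\<^sup>+y. ennreal (\<bar>f y\<bar> powr r) \<partial>N)"
    by (intro nn_integral_cmult) measurable
  also have "\<dots> \<le> ennreal (1 / c powr r) * ennreal (c powr r)"
    using f Lnorm_le_iff[of r c N] r c real by (intro mult_left_mono) auto
  also have "\<dots> = 1" using c by (simp add: ennreal_mult[symmetric])
  finally show ?thesis using Lnorm_le_iff[of r 1 N] r real by simp
next
  case PInf
  have "AE y in N. \<bar>f y\<bar> \<le> c" using Lnorm_infinity_le_iff[of f N c] f PInf c by simp
  then have "AE y in N. \<bar>1 / c * f y\<bar> \<le> 1"
    using c by (auto simp: abs_mult elim: eventually_mono)
  then show ?thesis using Lnorm_infinity_le_iff[of "\<lambda>y. 1 / c * f y" N 1] PInf by simp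
qed (use p in auto)

lemma simple_functions_measurable: "f \<in> simple_functions N \<Longrightarrow> f \<in> borel_measurable N"
  by (simp add: simple_functions_iff borel_measurable_simple_function)

lemma simple_functions_compose2:
  assumes "f \<in> simple_functions N" "g \<in> simple_functions N" "\<phi> 0 0 = 0"
  shows "(\<lambda>y. \<phi> (f y) (g y)) \<in> simple_functions N"
proof -
  note [measurable] = simple_functions_measurable[OF assms(1)] simple_functions_measurable[OF assms(2)]
  have sf: "simple_function N (\<lambda>y. \<phi> (f y) (g y))"
    using assms(1,2) simple_function_compose2[of N f g \<phi>] by (simp add: simple_functions_iff)
  have "emeasure N {y \<in> space N. \<phi> (f y) (g y) \<noteq> 0}
      \<le> emeasure N ({y \<in> space N. f y \<noteq> 0} \<union> {y \<in> space N. g y \<noteq> 0})"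
    using assms(3) by (intro emeasure_mono) auto
  also have "\<dots> \<le> emeasure N {y \<in> space N. f y \<noteq> 0} + emeasure N {y \<in> space N. g y \<noteq> 0}"
    by (intro emeasure_subadditive) measurable
  also have "\<dots> < \<infinity>" using assms(1,2) by (simp add: simple_functions_iff less_top)
  finally show ?thesis using sf by (simp add: simple_functions_iff)
qed

lemma simple_functions_Lnorm_finite:
  assumes f: "f \<in> simple_functions N" and p: "1 \<le> p"
  obtains l where "0 \<le> l" "Lnorm N p f = ennreal l"
proof -
  note [measurable] = simple_functions_measurable[OF f]
  have "finite (f ` space N)" using f by (simp add: simple_functions_iff simple_functionD)
  then have "bounded (f ` space N)" by (rule finite_imp_bounded)
  then obtain C where C: "0 < C" "\<And>y. y \<in> space N \<Longrightarrow> \<bar>f y\<bar> \<le> C"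
    by (auto simp: bounded_pos)
  have "Lnorm N p f < \<infinity>"
  proof (cases p)
    case (real r)
    then have r: "1 \<le> r" using p by simp
    have "(\<integral>\<^sup>+y. ennreal (\<bar>f y\<bar> powr r) \<partial>N)
        \<le> (\<integral>\<^sup>+y. ennreal (C powr r) * indicator {y \<in> space N. f y \<noteq> 0} y \<partial>N)"
      using C r by (intro nn_integral_mono) (auto simp: indicator_def intro!: ennreal_leI powr_mono2)
    also have "\<dots> = ennreal (C powr r) * emeasure N {y \<in> space N. f y \<noteq> 0}"
      by (intro nn_integral_cmult_indicator) measurable
    also have "\<dots> < \<infinity>" using f by (simp add: simple_functions_iff ennreal_mult_less_top less_top)
    finally obtain x where x: "0 \<le> x" "(\<integral>\<^sup>+y. ennreal (\<bar>f y\<bar> powr r) \<partial>N) = ennreal x"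
      by (cases "\<integral>\<^sup>+y. ennreal (\<bar>f y\<bar> powr r) \<partial>N") auto
    then have "Lnorm N (ereal r) f \<le> ennreal (x powr (1 / r))"
      using r by (subst Lnorm_le_iff) (auto simp: powr_powr)
    then show ?thesis using real by (auto intro: le_less_trans)
  next
    case PInf
    have "Lnorm N \<infinity> f \<le> ennreal C" using C by (subst Lnorm_infinity_le_iff) auto
    then show ?thesis using PInf by (auto intro: le_less_trans)
  qed (use p in auto)
  then show ?thesis using that by (cases "Lnorm N p f") auto
qed

section \<open>Images of unit balls under positive operators\<close>

lemma linear_operator_combine:
  assumes T: "linear_operator N M T" and f: "f \<in> simple_functions N" and g: "g \<in> simple_functions N"
  shows "AE x in M. T (\<lambda>y. a * f y + b * g y) x = a * T f x + b * T g x"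
proof -
  have af: "(\<lambda>y. a * f y) \<in> simple_functions N" and bg: "(\<lambda>y. b * g y) \<in> simple_functions N"
    using simple_functions_compose2[OF f f, of "\<lambda>u _. a * u"]
      simple_functions_compose2[OF g g, of "\<lambda>u _. b * u"] by simp_all
  have "AE x in M. T (\<lambda>y. a * f y + b * g y) x = T (\<lambda>y. a * f y) x + T (\<lambda>y. b * g y) x"
    using T af bg by (simp add: linear_operator_def)
  moreover have "AE x in M. T (\<lambda>y. a * f y) x = a * T f x"
    using T f by (simp add: linear_operator_def)
  moreover have "AE x in M. T (\<lambda>y. b * g y) x = b * T g x"
    using T g by (simp add: linear_operator_def)
  ultimately show ?thesis by eventually_elim simp
qed

text \<open>Positivity applied to \<open>\<bar>f\<bar> + f\<close> and to \<open>\<bar>f\<bar> - f\<close>. It reduces statements on arbitrary simple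
  functions to nonnegative ones.\<close>

lemma positive_operator_abs_le:
  assumes T: "linear_operator N M T" "positive_operator N M T" and f: "f \<in> simple_functions N"
  shows "AE x in M. \<bar>T f x\<bar> \<le> T (\<lambda>y. \<bar>f y\<bar>) x"
proof -
  have F: "(\<lambda>y. \<bar>f y\<bar>) \<in> simple_functions N"
    using simple_functions_compose2[OF f f, of "\<lambda>u _. \<bar>u\<bar>"] by simp
  have ge: "AE x in M. 0 \<le> 1 * T (\<lambda>y. \<bar>f y\<bar>) x + b * T f x" if "\<bar>b\<bar> = 1" for b :: real
  proof -
    have "(\<lambda>y. 1 * \<bar>f y\<bar> + b * f y) \<in> simple_functions N"
      using simple_functions_compose2[OF F f, of "\<lambda>u v. 1 * u + b * v"] by simp
    moreover have "AE y in N. 0 \<le> 1 * \<bar>f y\<bar> + b * f y"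
    proof (rule AE_I2)
      fix y
      have "\<bar>b * f y\<bar> \<le> \<bar>f y\<bar>" using that by (simp add: abs_mult)
      then show "0 \<le> 1 * \<bar>f y\<bar> + b * f y" by linarith
    qed
    ultimately have "AE x in M. 0 \<le> T (\<lambda>y. 1 * \<bar>f y\<bar> + b * f y) x"
      by (rule T(2)[unfolded positive_operator_def, rule_format])
    then show ?thesis
      using linear_operator_combine[OF T(1) F f, of 1 b] by eventually_elim simp
  qed
  have "AE x in M. 0 \<le> 1 * T (\<lambda>y. \<bar>f y\<bar>) x + 1 * T f x" by (rule ge) simp
  moreover have "AE x in M. 0 \<le> 1 * T (\<lambda>y. \<bar>f y\<bar>) x + (- 1) * T f x" by (rule ge) simp
  ultimately show ?thesis by eventually_elim linarith
qed

text \<open>Each member is a representative of the class of \<open>T f\<close> that is nonnegative everywhere, as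
  positivity gives \<open>T f \<ge> 0\<close> only almost everywhere.\<close>

definition unit_ball_image ::
    "'b measure \<Rightarrow> 'a measure \<Rightarrow> (('b \<Rightarrow> real) \<Rightarrow> 'a \<Rightarrow> real) \<Rightarrow> ereal \<Rightarrow> ('a \<Rightarrow> real) set" where
  "unit_ball_image N M T p = {v \<in> borel_measurable M. (\<forall>x. 0 \<le> v x) \<and>
     (\<exists>f\<in>simple_functions N. (\<forall>y\<in>space N. 0 \<le> f y) \<and> Lnorm N p f \<le> 1 \<and> (AE x in M. v x = T f x))}"

lemma unit_ball_imageI:
  assumes "v \<in> borel_measurable M" "\<And>x. 0 \<le> v x"
    and "f \<in> simple_functions N" "\<And>y. y \<in> space N \<Longrightarrow> 0 \<le> f y" "Lnorm N p f \<le> 1"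
    and "AE x in M. v x = T f x"
  shows "v \<in> unit_ball_image N M T p"
  unfolding unit_ball_image_def
  by (intro CollectI conjI allI bexI[of _ f] ballI) (fact assms | rule assms, assumption)+

lemma unit_ball_imageE:
  assumes "v \<in> unit_ball_image N M T p"
  obtains f where "f \<in> simple_functions N" "\<forall>y\<in>space N. 0 \<le> f y" "Lnorm N p f \<le> 1"
    "AE x in M. v x = T f x"
  using assms unfolding unit_ball_image_def by (elim CollectE conjE bexE)

lemma unit_ball_imageD:
  assumes "v \<in> unit_ball_image N M T p"
  shows "v \<in> borel_measurable M" "0 \<le> v x"
  using assms by (simp_all add: unit_ball_image_def)

lemma unit_ball_image_convex:
  assumes T: "linear_operator N M T" and p: "1 \<le> p"
    and v: "v \<in> unit_ball_image N M T p" and w: "w \<in> unit_ball_image N M T p"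
    and t: "0 \<le> t" "t \<le> 1"
  shows "(\<lambda>x. (1 - t) * v x + t * w x) \<in> unit_ball_image N M T p"
proof -
  obtain f where f: "f \<in> simple_functions N" "\<forall>y\<in>space N. 0 \<le> f y" "Lnorm N p f \<le> 1"
    "AE x in M. v x = T f x" using v by (rule unit_ball_imageE)
  obtain g where g: "g \<in> simple_functions N" "\<forall>y\<in>space N. 0 \<le> g y" "Lnorm N p g \<le> 1"
    "AE x in M. w x = T g x" using w by (rule unit_ball_imageE)
  note vw = unit_ball_imageD[OF v] unit_ball_imageD[OF w]
  show ?thesis
  proof (rule unit_ball_imageI)
    show "(\<lambda>x. (1 - t) * v x + t * w x) \<in> borel_measurable M"
      by (intro borel_measurable_add borel_measurable_times borel_measurable_const vw)
    show "0 \<le> (1 - t) * v x + t * w x" for x using vw t by simp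
    show "(\<lambda>y. (1 - t) * f y + t * g y) \<in> simple_functions N"
      using simple_functions_compose2[OF f(1) g(1), of "\<lambda>u v. (1 - t) * u + t * v"] by simp
    show "0 \<le> (1 - t) * f y + t * g y" if "y \<in> space N" for y using f(2) g(2) t that by simp
    show "Lnorm N p (\<lambda>y. (1 - t) * f y + t * g y) \<le> 1"
      by (intro Lnorm_ball_convex p t f g simple_functions_measurable)
    show "AE x in M. (1 - t) * v x + t * w x = T (\<lambda>y. (1 - t) * f y + t * g y) x"
      using linear_operator_combine[OF T f(1) g(1), of "1 - t" t] f(4) g(4)
      by eventually_elim simp
  qed
qed

text \<open>Any \<open>c\<close> above the norm serves as the scaling factor, which covers functions of norm 0 too.\<close>

lemma scaled_in_unit_ball_image:
  assumes T: "linear_operator N M T" "positive_operator N M T" and p: "1 \<le> p"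
    and f: "f \<in> simple_functions N" "\<forall>y\<in>space N. 0 \<le> f y"
    and c: "0 < c" "Lnorm N p f \<le> ennreal c"
  shows "(\<lambda>x. 1 / c * max 0 (T f x)) \<in> unit_ball_image N M T p"
proof -
  have Tf: "T f \<in> borel_measurable M" using T f by (simp add: linear_operator_def)
  show ?thesis
  proof (rule unit_ball_imageI)
    show "(\<lambda>x. 1 / c * max 0 (T f x)) \<in> borel_measurable M"
      by (intro borel_measurable_times borel_measurable_max borel_measurable_const Tf)
    show "0 \<le> 1 / c * max 0 (T f x)" for x using c by simp
    show "(\<lambda>y. 1 / c * f y) \<in> simple_functions N"
      using simple_functions_compose2[OF f(1) f(1), of "\<lambda>u _. 1 / c * u"] by simp
    show "0 \<le> 1 / c * f y" if "y \<in> space N" for y using f(2) c that by simp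
    show "Lnorm N p (\<lambda>y. 1 / c * f y) \<le> 1"
      by (intro Lnorm_scale_le_1 simple_functions_measurable f p c)
    have "AE x in M. 0 \<le> T f x"
      by (rule T(2)[unfolded positive_operator_def, rule_format, OF f(1)], rule AE_I2) (use f(2) in blast)
    then show "AE x in M. 1 / c * max 0 (T f x) = T (\<lambda>y. 1 / c * f y) x"
      using linear_operator_combine[OF T(1) f(1) f(1), of "1 / c" 0] by eventually_elim simp
  qed
qed

lemma unit_ball_image_saturates:
  assumes T: "linear_operator N M T" "positive_operator N M T" "saturates N M T" and p: "1 \<le> p"
    and E: "E \<in> sets M" "0 < emeasure M E"
  shows "\<exists>E'\<in>sets M. E' \<subseteq> E \<and> 0 < emeasure M E' \<and> (\<exists>h\<in>unit_ball_image N M T p. \<forall>x\<in>E'. 0 < h x)"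
proof -
  obtain F f where F: "F \<in> sets M" "F \<subseteq> E" "0 < emeasure M F"
    and f: "f \<in> simple_functions N" "\<forall>y\<in>space N. 0 \<le> f y" and pos: "AE x\<in>F in M. 0 < T f x"
    using T(3)[unfolded saturates_def, rule_format, OF E] by (elim bexE conjE)
  have [measurable]: "T f \<in> borel_measurable M" using T f by (simp add: linear_operator_def)
  note [measurable] = F(1)
  obtain l where l: "0 \<le> l" "Lnorm N p f = ennreal l"
    using simple_functions_Lnorm_finite[OF f(1) p] .
  define h where "h x = 1 / (l + 1) * max 0 (T f x)" for x
  have h: "h \<in> unit_ball_image N M T p"
    unfolding h_def[abs_def] using l by (intro scaled_in_unit_ball_image T p f) (auto intro: ennreal_leI)
  define F' where "F' = {x \<in> space M. x \<in> F \<and> 0 < T f x}"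
  have F': "F' \<in> sets M" unfolding F'_def by measurable
  have "AE x in M. x \<in> F \<longleftrightarrow> x \<in> F'"
    using pos AE_space by eventually_elim (auto simp: F'_def)
  then have "emeasure M F' = emeasure M F" by (intro emeasure_eq_AE F' F(1)) auto
  then have "0 < emeasure M F'" using F(3) by (simp only:)
  moreover have "\<forall>x\<in>F'. 0 < h x" using l by (simp add: F'_def h_def)
  moreover have "F' \<subseteq> E" using F(2) by (auto simp: F'_def)
  ultimately show ?thesis using F' h by blast
qed

lemma prod_ennreal_le_1:
  fixes f :: "'i \<Rightarrow> ennreal"
  assumes "finite I" "\<And>i. i \<in> I \<Longrightarrow> f i \<le> 1"
  shows "(\<Prod>i\<in>I. f i) \<le> 1"
  using assms
proof (induction I)
  case (insert i I)
  then show ?case using mult_mono[of "f i" 1 "prod f I" 1] by simp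
qed simp

section \<open>The duality theorem\<close>

theorem theorem1p6:
  fixes M :: "'a measure" and N :: "nat \<Rightarrow> 'b measure"
    and T :: "nat \<Rightarrow> ('b \<Rightarrow> real) \<Rightarrow> 'a \<Rightarrow> real"
    and d :: nat and p :: "nat \<Rightarrow> ereal" and \<alpha> :: "nat \<Rightarrow> real" and q A :: real
  assumes "sigma_finite_measure M"
    and "emeasure M (space M) \<noteq> 0"
    and "\<And>j. j \<in> {1..d} \<Longrightarrow> linear_operator (N j) M (T j)"
    and "\<And>j. j \<in> {1..d} \<Longrightarrow> positive_operator (N j) M (T j)"
    and "\<And>j. j \<in> {1..d} \<Longrightarrow> saturates (N j) M (T j)"
    and "\<And>j. j \<in> {1..d} \<Longrightarrow> 1 \<le> p j"
    and "0 < q" and "q < 1"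
    and "\<And>j. j \<in> {1..d} \<Longrightarrow> 0 < \<alpha> j"
    and "(\<Sum>j=1..d. \<alpha> j) = 1"
    and "0 \<le> A"
    and "\<And>f :: nat \<Rightarrow> 'b \<Rightarrow> real.
           (\<And>j. j \<in> {1..d} \<Longrightarrow> f j \<in> simple_functions (N j) \<and> (\<forall>y\<in>space (N j). 0 \<le> f j y)) \<Longrightarrow>
           Lnorm M (ereal q) (\<lambda>x. \<Prod>j=1..d. T j (f j) x powr \<alpha> j)
             \<le> ennreal A * (\<Prod>j=1..d. epowr (Lnorm (N j) (p j) (f j)) (\<alpha> j))"
  shows "\<exists>g :: nat \<Rightarrow> 'a \<Rightarrow> real.
           (\<forall>j\<in>{1..d}. g j \<in> borel_measurable M \<and> (\<forall>x\<in>space M. 0 \<le> g j x)) \<and>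
           Lnorm M (ereal (q / (q - 1))) (\<lambda>x. \<Prod>j=1..d. g j x powr \<alpha> j) = 1 \<and>
           (\<forall>j\<in>{1..d}. \<forall>f\<in>simple_functions (N j).
              integrable M (\<lambda>x. g j x * T j f x) \<and>
              ereal (\<integral>x. g j x * T j f x \<partial>M) \<le> ereal A * enn2ereal (Lnorm (N j) (p j) f))"
proof -
  note T = assms(3-5) and p = assms(6) and ineq = assms(12)
  define K where "K j = unit_ball_image (N j) M (T j) (p j)" for j
  have bounded: "(\<integral>\<^sup>+x. ennreal (geometric_mean {1..d} \<alpha> (\<lambda>i. u i x) powr q) \<partial>M) \<le> ennreal (A powr q)"
    if u: "\<And>i. i \<in> {1..d} \<Longrightarrow> u i \<in> K i" for u
  proof -
    have "\<forall>i\<in>{1..d}. \<exists>f. f \<in> simple_functions (N i) \<and> (\<forall>y\<in>space (N i). 0 \<le> f y) \<and>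
        Lnorm (N i) (p i) f \<le> 1 \<and> (AE x in M. u i x = T i f x)"
      using u unfolding K_def by (intro ballI) (erule unit_ball_imageE[OF u[unfolded K_def]], iprover)
    then obtain f where f: "\<And>i. i \<in> {1..d} \<Longrightarrow> f i \<in> simple_functions (N i) \<and> (\<forall>y\<in>space (N i). 0 \<le> f i y)"
      and f1: "\<And>i. i \<in> {1..d} \<Longrightarrow> Lnorm (N i) (p i) (f i) \<le> 1"
      and fu: "\<And>i. i \<in> {1..d} \<Longrightarrow> AE x in M. u i x = T i (f i) x"
      unfolding bchoice_iff by blast
    have "Lnorm M (ereal q) (\<lambda>x. \<Prod>j=1..d. T j (f j) x powr \<alpha> j)
        \<le> ennreal A * (\<Prod>j=1..d. epowr (Lnorm (N j) (p j) (f j)) (\<alpha> j))"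
      by (rule ineq) (rule f)
    also have "\<dots> \<le> ennreal A * 1"
      using f1 assms(9) by (intro mult_left_mono prod_ennreal_le_1 epowr_le_1) auto
    finally have "(\<integral>\<^sup>+x. ennreal (\<bar>\<Prod>j=1..d. T j (f j) x powr \<alpha> j\<bar> powr q) \<partial>M) \<le> ennreal (A powr q)"
      using Lnorm_le_iff[OF assms(7,11), of M] by simp
    moreover have "(\<integral>\<^sup>+x. ennreal (geometric_mean {1..d} \<alpha> (\<lambda>i. u i x) powr q) \<partial>M)
        = (\<integral>\<^sup>+x. ennreal (\<bar>\<Prod>j=1..d. T j (f j) x powr \<alpha> j\<bar> powr q) \<partial>M)"
    proof (rule nn_integral_cong_AE)
      have "AE x in M. \<forall>i\<in>{1..d}. u i x = T i (f i) x"
        using fu by (simp add: AE_finite_all)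
      then show "AE x in M. ennreal (geometric_mean {1..d} \<alpha> (\<lambda>i. u i x) powr q)
          = ennreal (\<bar>\<Prod>j=1..d. T j (f j) x powr \<alpha> j\<bar> powr q)"
        by eventually_elim (simp add: geometric_mean_def prod_nonneg)
    qed
    ultimately show ?thesis by simp
  qed
  interpret sigma_finite_measure M by fact
  interpret saturating_family "{1..d}" \<alpha> M K q "A powr q"
  proof unfold_locales
    show "v \<in> borel_measurable M" "0 \<le> v x" if "i \<in> {1..d}" "v \<in> K i" for i v x
      using that unit_ball_imageD unfolding K_def by metis+
    show "(\<lambda>x. (1 - t) * v x + t * w x) \<in> K i"
      if "i \<in> {1..d}" "v \<in> K i" "w \<in> K i" "0 \<le> t" "t \<le> 1" for i v w t
      using that unfolding K_def by (intro unit_ball_image_convex T p)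
    show "\<exists>E'\<in>sets M. E' \<subseteq> E \<and> 0 < emeasure M E' \<and> (\<exists>h\<in>K i. \<forall>x\<in>E'. 0 < h x)"
      if "i \<in> {1..d}" "E \<in> sets M" "0 < emeasure M E" for i E
      using that unfolding K_def by (intro unit_ball_image_saturates T p)
  qed (use assms(2,7-10) bounded in auto)
  obtain g where g_meas: "\<And>i. i \<in> {1..d} \<Longrightarrow> g i \<in> borel_measurable M"
    and g_pos: "\<And>i x. i \<in> {1..d} \<Longrightarrow> 0 < g i x"
    and g_norm: "(\<integral>\<^sup>+x. ennreal (gmean (\<lambda>i. g i x) powr (q / (q - 1))) \<partial>M) = 1"
    and g_K: "\<And>i v. i \<in> {1..d} \<Longrightarrow> v \<in> K i \<Longrightarrow>
        (\<integral>\<^sup>+x. ennreal (g i x * v x) \<partial>M) \<le> ennreal (max_energy powr (1 / q))"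
    using exists_dual_weights by blast
  have "max_energy powr (1 / q) \<le> (A powr q) powr (1 / q)"
    using max_energy_le_bound max_energy_pos assms(7) by (intro powr_mono2) auto
  then have max_le: "max_energy powr (1 / q) \<le> A" using assms(7,11) by (simp add: powr_powr)
  have norm: "Lnorm M (ereal (q / (q - 1))) (\<lambda>x. \<Prod>j=1..d. g j x powr \<alpha> j) = 1"
  proof -
    have "epowr (ennreal \<bar>\<Prod>j=1..d. g j x powr \<alpha> j\<bar>) (q / (q - 1))
        = ennreal (gmean (\<lambda>i. g i x) powr (q / (q - 1)))" for x
      using gmean_pos[of "\<lambda>i. g i x"] g_pos assms(7,8) unfolding geometric_mean_def epowr_def
      by (auto simp: ennreal_eq_0_iff)
    then have "Lnorm M (ereal (q / (q - 1))) (\<lambda>x. \<Prod>j=1..d. g j x powr \<alpha> j) = epowr 1 (1 / (q / (q - 1)))"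
      by (simp only: Lnorm_def real_of_ereal.simps g_norm infinity_ereal_def ereal.distinct if_False)
    then show ?thesis by (simp add: epowr_def)
  qed
  have dual: "integrable M (\<lambda>x. g j x * T j f x) \<and>
      ereal (\<integral>x. g j x * T j f x \<partial>M) \<le> ereal A * enn2ereal (Lnorm (N j) (p j) f)"
    if j: "j \<in> {1..d}" and f: "f \<in> simple_functions (N j)" for j f
  proof -
    let ?F = "\<lambda>y. \<bar>f y\<bar>"
    have F: "?F \<in> simple_functions (N j)"
      using simple_functions_compose2[OF f f, of "\<lambda>u _. \<bar>u\<bar>"] by simp
    have Tf_meas: "T j f \<in> borel_measurable M" and TF_meas: "T j ?F \<in> borel_measurable M"
      using T(1)[OF j] f F by (simp_all add: linear_operator_def)
    note [measurable] = Tf_meas TF_meas g_meas[OF j]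
    obtain l where l: "0 \<le> l" "Lnorm (N j) (p j) f = ennreal l"
      using simple_functions_Lnorm_finite[OF f p[OF j]] .
    have "Lnorm (N j) (p j) ?F = Lnorm (N j) (p j) f" by (simp add: Lnorm_def)
    then have lF: "Lnorm (N j) (p j) ?F = ennreal l" using l(2) by (rule trans)
    have le: "(\<integral>\<^sup>+x. ennreal \<bar>g j x * T j f x\<bar> \<partial>M) \<le> ennreal (A * c)" if c: "l < c" for c
    proof -
      have c0: "0 < c" using l c by simp
      define v where "v x = 1 / c * max 0 (T j ?F x)" for x
      have v: "v \<in> K j"
        unfolding K_def v_def[abs_def] using c0 c lF
        by (intro scaled_in_unit_ball_image T p F j) (auto intro: ennreal_leI)
      have [measurable]: "v \<in> borel_measurable M" unfolding v_def[abs_def] by measurable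
      have v0: "0 \<le> v x" for x using c0 by (simp add: v_def)
      have "(\<integral>\<^sup>+x. ennreal \<bar>g j x * T j f x\<bar> \<partial>M) \<le> (\<integral>\<^sup>+x. ennreal c * ennreal (g j x * v x) \<partial>M)"
      proof (rule nn_integral_mono_AE)
        show "AE x in M. ennreal \<bar>g j x * T j f x\<bar> \<le> ennreal c * ennreal (g j x * v x)"
          using positive_operator_abs_le[OF T(1,2)[OF j] f]
        proof eventually_elim
          case (elim x)
          have "\<bar>g j x * T j f x\<bar> \<le> c * (g j x * v x)"
            using elim g_pos[OF j, of x] c0 by (auto simp: v_def abs_mult)
          then show ?case using c0 v0[of x] g_pos[OF j, of x]
            by (simp add: ennreal_mult[symmetric] ennreal_leI)
        qed
      qed
      also have "\<dots> = ennreal c * (\<integral>\<^sup>+x. ennreal (g j x * v x) \<partial>M)"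
        by (intro nn_integral_cmult) measurable
      also have "\<dots> \<le> ennreal c * ennreal A"
        using g_K[OF j v] max_le by (intro mult_left_mono) (auto intro: order_trans ennreal_leI)
      also have "\<dots> = ennreal (A * c)" using c0 assms(11) by (simp add: ennreal_mult[symmetric] mult.commute)
      finally show ?thesis .
    qed
    have int: "integrable M (\<lambda>x. g j x * T j f x)"
    proof (rule integrableI_bounded)
      show "(\<integral>\<^sup>+x. ennreal (norm (g j x * T j f x)) \<partial>M) < \<infinity>"
        using le[of "l + 1"] by (auto intro: le_less_trans)
    qed measurable
    \<comment> \<open>The bound \<open>A * c\<close> holds for every \<open>c > l\<close>; take \<open>c = l + e / (A + 1)\<close> and let \<open>e\<close> tend to 0.\<close>
    have "(\<integral>x. g j x * T j f x \<partial>M) \<le> A * l + e" if e: "0 < e" for e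
    proof -
      define c where "c = l + e / (A + 1)"
      have c: "l < c" using e assms(11) by (simp add: c_def)
      have "(\<integral>x. g j x * T j f x \<partial>M) \<le> (\<integral>x. \<bar>g j x * T j f x\<bar> \<partial>M)"
        by (intro integral_mono int integrable_abs) auto
      also have "\<dots> \<le> A * c"
      proof -
        have "ennreal (\<integral>x. \<bar>g j x * T j f x\<bar> \<partial>M) \<le> ennreal (A * c)"
          using le[OF c] nn_integral_eq_integral[OF integrable_abs[OF int]] by simp
        moreover have "0 \<le> A * c" using assms(11) l c by simp
        ultimately show ?thesis by (simp add: ennreal_le_iff)
      qed
      also have "A * c \<le> A * l + e"
      proof -
        have "A * (e / (A + 1)) \<le> e" using e assms(11) by (simp add: field_simps)
        then show ?thesis by (simp add: c_def distrib_left)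
      qed
      finally show ?thesis .
    qed
    then have "(\<integral>x. g j x * T j f x \<partial>M) \<le> A * l" by (rule field_le_epsilon)
    then show ?thesis using int l by simp
  qed
  show ?thesis
    using g_meas g_pos norm dual by (intro exI[of _ g]) (auto simp: less_imp_le)
qed

end
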